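(* The posets $F_n^0$, $F_n^1$, $F_n^{n-2}$, and $F_n^n$ are the only graded conjugacy classes of involutions in $S_n$; that is, a (nonempty) conjugacy class $F_n^a$ is graded if and only if $a\in\{0,1,n-2,n\}$. Furthermore, the rank function $\rho$ of $F_n^0$ (when $n$ is even) and of $F_n^1$ (when $n$ is odd) is given by $$\rho(\sigma)=\frac{\mathrm{inv}(\sigma)-\lfloor n/2\rfloor}{2},$$ and the rank function $\rho$ of $F_n^{n-2}$ (for $n\geq 2$) is given by $$\rho(\sigma)=\frac{\mathrm{inv}(\sigma)-1}{2}.$$
   Context: $S_n$ is the symmetric group on $[n]=\{1,\ldots,n\}$, partially ordered by the Bruhat order: for $\sigma\in S_n$ and $(k,l)\in[n]^2$ let $\sigma[k,l]=|\{i\le k : \sigma(i)\ge l\}|$; then $\sigma\le\tau$ iff $\sigma[k,l]\le\tau[k,l]$ for all $(k,l)\in[n]^2$. An involution is a $\sigma\in S_n$ with $\sigma^2=\mathrm{id}$ (the identity is included). For $a\in\{0,1,\ldots,n\}$, $F_n^a$ is the set of involutions in $S_n$ with exactly $a$ fixed points, with the order induced by the Bruhat order; it is nonempty exactly when $a\equiv n\pmod 2$, and then it is a conjugacy class of $S_n$. $\mathrm{inv}(\sigma)$ is the number of pairs $i<j$ with $\sigma(i)>\sigma(j)$. A finite poset is graded of rank $r$ if every maximal chain has length $r$ (length = number of elements minus one); its rank function $\rho$ is the unique function with $\rho(x)=0$ for $x$ minimal and $\rho(y)=\rho(x)+1$ whenever $y$ covers $x$ in the poset. *)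

theory Defs
  imports Complex_Main "HOL-Combinatorics.Permutations"
begin

text \<open>
  A permutation of \<open>[n]\<close> is a function \<open>s :: nat \<Rightarrow> nat\<close> with \<open>s permutes {1..n}\<close>; such a function
  is the identity outside \<open>{1..n}\<close>, so equality of functions is equality of permutations.
\<close>

definition bruhat_count :: "(nat \<Rightarrow> nat) \<Rightarrow> nat \<Rightarrow> nat \<Rightarrow> nat" where
  "bruhat_count s k l = card {i \<in> {1..k}. s i \<ge> l}"

definition bruhat_le :: "nat \<Rightarrow> (nat \<Rightarrow> nat) \<Rightarrow> (nat \<Rightarrow> nat) \<Rightarrow> bool" where
  "bruhat_le n s t \<longleftrightarrow>
     (\<forall>k\<in>{1..n}. \<forall>l\<in>{1..n}. bruhat_count s k l \<le> bruhat_count t k l)"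

definition inv_number :: "nat \<Rightarrow> (nat \<Rightarrow> nat) \<Rightarrow> nat" where
  "inv_number n s = card {(i, j). i \<in> {1..n} \<and> j \<in> {1..n} \<and> i < j \<and> s i > s j}"

definition invol_class :: "nat \<Rightarrow> nat \<Rightarrow> (nat \<Rightarrow> nat) set" where
  "invol_class n a =
     {s. s permutes {1..n} \<and> s \<circ> s = id \<and> card {i \<in> {1..n}. s i = i} = a}"

text \<open>
  Below, \<open>A\<close> is the carrier of a finite poset and \<open>le\<close> its reflexive order relation. A chain with
  \<open>r + 1\<close> elements has length \<open>r\<close>; \<^const>\<open>pred_on.maxchain\<close> takes the reflexive closure of the
  relation it is given, so \<open>le\<close> may be passed as it is.
\<close>

definition graded_poset_of_rank :: "'a set \<Rightarrow> ('a \<Rightarrow> 'a \<Rightarrow> bool) \<Rightarrow> nat \<Rightarrow> bool" where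
  "graded_poset_of_rank A le r \<longleftrightarrow> (\<forall>C. pred_on.maxchain A le C \<longrightarrow> card C = r + 1)"

definition graded_poset :: "'a set \<Rightarrow> ('a \<Rightarrow> 'a \<Rightarrow> bool) \<Rightarrow> bool" where
  "graded_poset A le \<longleftrightarrow> (\<exists>r. graded_poset_of_rank A le r)"

definition minimal_in :: "'a set \<Rightarrow> ('a \<Rightarrow> 'a \<Rightarrow> bool) \<Rightarrow> 'a \<Rightarrow> bool" where
  "minimal_in A le x \<longleftrightarrow> x \<in> A \<and> (\<forall>z\<in>A. le z x \<longrightarrow> z = x)"

definition covers_in :: "'a set \<Rightarrow> ('a \<Rightarrow> 'a \<Rightarrow> bool) \<Rightarrow> 'a \<Rightarrow> 'a \<Rightarrow> bool" where
  "covers_in A le y x \<longleftrightarrow>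
     x \<in> A \<and> y \<in> A \<and> le x y \<and> x \<noteq> y \<and> (\<forall>z\<in>A. le x z \<and> le z y \<longrightarrow> z = x \<or> z = y)"

text \<open>Values outside \<open>A\<close> are irrelevant, so uniqueness of a rank function means uniqueness on \<open>A\<close>.\<close>

definition is_rank_function :: "'a set \<Rightarrow> ('a \<Rightarrow> 'a \<Rightarrow> bool) \<Rightarrow> ('a \<Rightarrow> nat) \<Rightarrow> bool" where
  "is_rank_function A le \<rho> \<longleftrightarrow>
     (\<forall>x. minimal_in A le x \<longrightarrow> \<rho> x = 0) \<and>
     (\<forall>x y. covers_in A le y x \<longrightarrow> \<rho> y = \<rho> x + 1)"

text \<open>
  The rank function of the poset exists and is given by \<open>f\<close>. The function \<open>f\<close> is real-valued so
  that a formula with a division can be given literally; integrality of its values on \<open>A\<close> is part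
  of the claim.
\<close>

definition rank_function_given_by ::
    "'a set \<Rightarrow> ('a \<Rightarrow> 'a \<Rightarrow> bool) \<Rightarrow> ('a \<Rightarrow> real) \<Rightarrow> bool" where
  "rank_function_given_by A le f \<longleftrightarrow>
     (\<exists>\<rho>. is_rank_function A le \<rho>) \<and>
     (\<forall>\<rho>. is_rank_function A le \<rho> \<longrightarrow> (\<forall>x\<in>A. real (\<rho> x) = f x))"

end

theory Submission
  imports Defs
begin

text \<open>
  Write \<open>M\<^sub>s(k, l)\<close> for the number of \<open>i \<le> k\<close> with \<open>s i \<le> l\<close>. The Bruhat order is the reverse of the
  pointwise order of these tables, and the table of an involution is symmetric. Multiplying \<open>s\<close> on the
  right by the adjacent transposition \<open>(i, i + 1)\<close> changes row \<open>i\<close> only, and the two possible rows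
  are the least and the greatest ones that fit between rows \<open>i - 1\<close> and \<open>i + 1\<close>: the least if there is
  a descent at \<open>i\<close>, the greatest if there is an ascent. This is the lifting property. For an involution
  it is used on both sides, so that conjugation by \<open>(i, i + 1)\<close> goes up at an ascent and down at a
  descent, changing the number of inversions by \<open>2\<close>. The exceptions are a two-cycle \<open>(i, i + 1)\<close> and
  a pair of adjacent fixed points, which the conjugation leaves alone. A descent that is not a
  two-cycle is called proper.

  An involution without proper descents is a product of disjoint adjacent transpositions, so minimal
  elements of \<open>F\<^sub>n\<^sup>a\<close> have \<open>(n - a) / 2\<close> inversions. The claims about rank functions therefore follow
  once every cover is known to add exactly two inversions, and gradedness follows because each of the
  four classes has a greatest element.

  For \<open>a \<le> 1\<close> the statement on covers is \<open>inv_number_cover\<close>, by induction on the inversions of the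
  upper element \<open>t\<close> of a cover \<open>s < t\<close>. Let \<open>i\<close> be a proper descent of \<open>t\<close>. If \<open>i\<close> is an ascent of \<open>s\<close>,
  conjugating \<open>s\<close> stays below \<open>t\<close> and so gives \<open>t\<close>. If it is a proper descent of \<open>s\<close>, conjugating both
  gives a smaller cover with the same difference. If \<open>(i, i + 1)\<close> is a two-cycle of \<open>s\<close>, a parity
  argument on the diagonal of the tables shows that \<open>s\<close> is usually below the conjugate of \<open>t\<close>, which
  then equals \<open>s\<close>. This parity argument can fail only if \<open>s\<close> and \<open>t\<close> have one fixed point each and
  these lie in different places. If it fails at every proper descent of \<open>t\<close>, then looking at
  the first of them (the last, if the fixed points are in the other order) determines enough of both
  involutions to exhibit a third one strictly between them (\<open>between_if_stuck\<close>), so \<open>s < t\<close> was not a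
  cover.

  For \<open>a = n - 2\<close> the elements are transpositions \<open>(i, j)\<close>, ordered by inclusion of the intervals
  \<open>[i, j]\<close>. For \<open>2 \<le> a \<le> n - 4\<close> an interval of \<open>F\<^sub>6\<^sup>2\<close> has maximal chains of lengths \<open>2\<close> and at least
  \<open>3\<close>; appending fixed points and adjacent two-cycles transports this interval to \<open>F\<^sub>n\<^sup>a\<close>.
\<close>

section \<open>Low counts and the Bruhat order\<close>

text \<open>
  Counting small instead of large values makes the table of an involution symmetric and lets the
  bounds \<open>k\<close> and \<open>l\<close> range over all natural numbers, without reference to \<open>n\<close>.
\<close>

definition low_count :: "(nat \<Rightarrow> nat) \<Rightarrow> nat \<Rightarrow> nat \<Rightarrow> nat" where
  "low_count s k l = card {i \<in> {1..k}. s i \<le> l}"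

definition low_le :: "(nat \<Rightarrow> nat) \<Rightarrow> (nat \<Rightarrow> nat) \<Rightarrow> bool" where
  "low_le s t \<longleftrightarrow> (\<forall>k l. low_count t k l \<le> low_count s k l)"

lemma low_count_0 [simp]: "low_count s 0 l = 0"
  by (simp add: low_count_def)

lemma low_count_Suc:
  "low_count s (Suc k) l = low_count s k l + (if s (Suc k) \<le> l then 1 else 0)"
proof -
  have "{i \<in> {1..Suc k}. s i \<le> l} =
        (if s (Suc k) \<le> l then insert (Suc k) {i \<in> {1..k}. s i \<le> l} else {i \<in> {1..k}. s i \<le> l})"
    by (auto simp: le_Suc_eq)
  then show ?thesis by (auto simp: low_count_def)
qed

lemma low_count_pos:
  "0 < i \<Longrightarrow> low_count s i l = low_count s (i - 1) l + (if s i \<le> l then 1 else 0)"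
  by (cases i) (simp_all add: low_count_Suc)

lemma low_count_le: "low_count s k l \<le> k"
  by (induction k) (auto simp: low_count_Suc)

lemma low_count_cong: "(\<And>i. 1 \<le> i \<Longrightarrow> i \<le> k \<Longrightarrow> s i \<le> l \<longleftrightarrow> t i \<le> l) \<Longrightarrow> low_count s k l = low_count t k l"
  unfolding low_count_def by (rule arg_cong[of _ _ card]) auto

text \<open>
  A full count at \<open>(k, k)\<close> says that \<open>s\<close> maps \<open>{1..k}\<close> to itself; going down in the order makes counts
  larger, so it preserves such cuts.
\<close>

lemma low_count_eq_full_iff: "low_count s k l = k \<longleftrightarrow> (\<forall>i. 1 \<le> i \<and> i \<le> k \<longrightarrow> s i \<le> l)"
proof (induction k)
  case (Suc k)
  have "low_count s k l \<le> k" by (rule low_count_le)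
  then show ?case using Suc by (auto simp: low_count_Suc le_Suc_eq)
qed simp

lemma low_count_inverse:
  assumes "\<And>i. p (q i) = i" "\<And>i. q (p i) = i" "p 0 = 0" "q 0 = 0"
  shows "low_count q k l = low_count p l k"
proof -
  have pos: "1 \<le> q i" "1 \<le> p i" if "1 \<le> i" for i
    using assms(1)[of i] assms(2)[of i] assms(3,4) that by (cases "q i"; cases "p i"; simp)+
  have "bij_betw q {i \<in> {1..k}. q i \<le> l} {i \<in> {1..l}. p i \<le> k}"
    by (rule bij_betwI[where g = p]) (use assms pos in auto)
  then show ?thesis unfolding low_count_def by (rule bij_betw_same_card)
qed

lemma low_count_permutes_outside:
  assumes "s permutes {1..n}" "n \<le> k \<or> n \<le> l"
  shows "low_count s k l = min k l"
proof -
  have *: "low_count t k l = min k l" if "t permutes {1..n}" "n \<le> l" for t k l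
  proof -
    have iff: "t i \<le> l \<longleftrightarrow> i \<le> l" for i
      using that(2) permutes_in_image[OF that(1), of i] permutes_not_in[OF that(1), of i]
      by (cases "i \<in> {1..n}") auto
    have "{i \<in> {1..k}. t i \<le> l} = {1..min k l}"
      unfolding iff by auto
    then show ?thesis by (simp add: low_count_def)
  qed
  show ?thesis
  proof (cases "n \<le> l")
    case False
    have "low_count s k l = low_count (inv s) l k"
      using permutes_inverses[OF assms(1)] permutes_not_in[OF assms(1), of 0]
        permutes_not_in[OF permutes_inv[OF assms(1)], of 0]
      by (intro low_count_inverse) auto
    also have "\<dots> = min l k"
      using False assms by (intro * permutes_inv) auto
    finally show ?thesis by simp
  qed (rule *[OF assms(1)])
qed

lemma bruhat_count_Suc: "bruhat_count s k (Suc l) = k - low_count s k l"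
proof -
  have "{i \<in> {1..k}. Suc l \<le> s i} = {1..k} - {i \<in> {1..k}. s i \<le> l}" by auto
  moreover have "card ({1..k} - {i \<in> {1..k}. s i \<le> l}) = card {1..k} - card {i \<in> {1..k}. s i \<le> l}"
    by (rule card_Diff_subset) auto
  ultimately show ?thesis
    unfolding bruhat_count_def low_count_def by simp
qed

lemma bruhat_le_iff_low_le:
  assumes "s permutes {1..n}" "t permutes {1..n}"
  shows "bruhat_le n s t \<longleftrightarrow> low_le s t"
proof
  assume le: "bruhat_le n s t"
  show "low_le s t"
    unfolding low_le_def
  proof (intro allI)
    fix k l
    show "low_count t k l \<le> low_count s k l"
    proof (cases "n \<le> k \<or> n \<le> l \<or> k = 0")
      case True
      then show ?thesis
        using low_count_permutes_outside[OF assms(1), of k l]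
              low_count_permutes_outside[OF assms(2), of k l] by auto
    next
      case False
      then have "bruhat_count s k (Suc l) \<le> bruhat_count t k (Suc l)"
        using le unfolding bruhat_le_def by auto
      then show ?thesis
        using low_count_le[of s k l] low_count_le[of t k l] by (simp add: bruhat_count_Suc)
    qed
  qed
next
  assume le: "low_le s t"
  show "bruhat_le n s t"
    unfolding bruhat_le_def
  proof (intro ballI)
    fix k l assume "l \<in> {1..n}"
    then obtain l' where "l = Suc l'" by (cases l) auto
    then show "bruhat_count s k l \<le> bruhat_count t k l"
      using le by (auto simp: bruhat_count_Suc low_le_def intro: diff_le_mono2)
  qed
qed

lemma low_le_refl: "low_le s s"
  by (simp add: low_le_def)

lemma low_le_trans: "low_le s t \<Longrightarrow> low_le t u \<Longrightarrow> low_le s u"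
  by (meson low_le_def order_trans)

lemma low_count_rows_determine:
  assumes "0 < k" "\<And>l. low_count s (k - 1) l = low_count t (k - 1) l"
    "\<And>l. low_count s k l = low_count t k l"
  shows "s k = t k"
proof -
  have "s k \<le> l \<longleftrightarrow> t k \<le> l" for l
    using low_count_pos[OF assms(1), of s l] low_count_pos[OF assms(1), of t l]
      assms(2,3)[of l]
    by (cases "s k \<le> l"; cases "t k \<le> l"; simp)
  from this[of "s k"] this[of "t k"] show ?thesis by simp
qed

lemma low_le_antisym:
  assumes "low_le s t" "low_le t s" "s 0 = t 0"
  shows "s = t"
proof
  fix k
  have "low_count s k l = low_count t k l" for k l
    using assms(1,2) by (meson low_le_def order_antisym)
  then show "s k = t k"
    using assms(3) low_count_rows_determine by (cases "k = 0") auto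
qed

section \<open>Lifting along adjacent transpositions\<close>

text \<open>
  The index \<open>i\<close> of an adjacent transposition is assumed positive throughout, because the point \<open>0\<close> lies
  outside of every \<open>{1..n}\<close>.
\<close>

abbreviation adj :: "nat \<Rightarrow> nat \<Rightarrow> nat" where
  "adj i \<equiv> transpose i (Suc i)"

definition conj_adj :: "nat \<Rightarrow> (nat \<Rightarrow> nat) \<Rightarrow> nat \<Rightarrow> nat" where
  "conj_adj i s = adj i \<circ> s \<circ> adj i"

text \<open>
  The conditions on an involution of \<open>{1..n}\<close> that do not mention \<open>n\<close>; fixing \<open>0\<close> keeps positive points
  positive.
\<close>

definition invol :: "(nat \<Rightarrow> nat) \<Rightarrow> bool" where
  "invol s \<longleftrightarrow> (\<forall>i. s (s i) = i) \<and> s 0 = 0"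

lemma invol_simps [simp]: "invol s \<Longrightarrow> s (s i) = i" "invol s \<Longrightarrow> s 0 = 0"
  by (auto simp: invol_def)

lemma invol_eq_iff: "invol s \<Longrightarrow> s i = s j \<longleftrightarrow> i = j"
  by (metis invol_simps(1))

lemma invol_pos_iff [simp]: "invol s \<Longrightarrow> 0 < s i \<longleftrightarrow> 0 < i"
  by (metis invol_simps not_gr_zero)

lemma low_count_sym: "invol s \<Longrightarrow> low_count s k l = low_count s l k"
  by (rule low_count_inverse) auto

lemma low_count_right_adj:
  assumes "0 < i"
  shows "low_count (s \<circ> adj i) k l =
    (if k = i then low_count s (i - 1) l + (if s (Suc i) \<le> l then 1 else 0) else low_count s k l)"
proof -
  have below: "low_count (s \<circ> adj i) k l = low_count s k l" if "k < i" for k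
    by (rule low_count_cong) (use that in \<open>auto simp: transpose_def\<close>)
  have at: "low_count (s \<circ> adj i) i l = low_count s (i - 1) l + (if s (Suc i) \<le> l then 1 else 0)"
    using below[of "i - 1"] assms by (simp add: low_count_pos)
  have above: "low_count (s \<circ> adj i) k l = low_count s k l" if "Suc i \<le> k" for k
    using that
  proof (induction k rule: dec_induct)
    case base
    show ?case using at low_count_pos[OF assms, of s l]
      unfolding low_count_Suc by (simp del: comp_apply add: comp_apply[of s "adj i" "Suc i"])
  next
    case (step k)
    then show ?case by (simp add: low_count_Suc transpose_def)
  qed
  show ?thesis using at below above by (metis linorder_neqE_nat less_eq_Suc_le)
qed

text \<open>
  With rows \<open>i - 1\<close> and \<open>i + 1\<close> given, the entry \<open>x\<close> of row \<open>i\<close> satisfies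
  \<open>max a (b - 1) \<le> x \<le> min (a + 1) b\<close>, where \<open>a\<close> and \<open>b\<close> are its neighbours in the column. A descent at \<open>i\<close>
  means that the lower bound is attained in every column, an ascent that the upper bound is. Both
  bounds are monotone in \<open>a\<close> and \<open>b\<close>, hence a permutation with a descent at \<open>i\<close> stays above every
  rearrangement of a lower permutation at \<open>i\<close>; the next lemma is the dual.
\<close>

lemma low_le_right_adj_lower:
  assumes "0 < i" "low_le s t" "t (Suc i) < t i"
  shows "low_le (s \<circ> adj i) t"
  unfolding low_le_def
proof (intro allI)
  fix k l
  have "low_count t k l \<le> low_count s k l" "low_count t (i - 1) l \<le> low_count s (i - 1) l"
    "low_count t (Suc i) l \<le> low_count s (Suc i) l"
    using assms(2) by (auto simp: low_le_def)
  then show "low_count t k l \<le> low_count (s \<circ> adj i) k l"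
    using assms(1,3) low_count_pos[OF assms(1), of s l] low_count_pos[OF assms(1), of t l]
    by (auto simp: low_count_right_adj low_count_Suc split: if_splits)
qed

lemma low_le_right_adj_upper:
  assumes "0 < i" "low_le s t" "s i < s (Suc i)"
  shows "low_le s (t \<circ> adj i)"
  unfolding low_le_def
proof (intro allI)
  fix k l
  have "low_count t k l \<le> low_count s k l" "low_count t (i - 1) l \<le> low_count s (i - 1) l"
    "low_count t (Suc i) l \<le> low_count s (Suc i) l"
    using assms(2) by (auto simp: low_le_def)
  then show "low_count (t \<circ> adj i) k l \<le> low_count s k l"
    using assms(1,3) low_count_pos[OF assms(1), of s l] low_count_pos[OF assms(1), of t l]
    by (auto simp: low_count_right_adj low_count_Suc split: if_splits)
qed

lemma low_count_swap_right_left: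
  assumes "invol s" "0 < i"
  shows "low_count (adj i \<circ> s) k l = low_count (s \<circ> adj i) l k"
proof (rule low_count_inverse)
  show "(s \<circ> adj i) 0 = 0" "(adj i \<circ> s) 0 = 0" using assms by (simp_all add: transpose_def)
qed (simp_all add: assms(1))

text \<open>
  The lifting property is applied on the right, then on the left: the tables of \<open>s \<circ> adj i\<close> and
  \<open>adj i \<circ> s\<close> are transposes of each other, whereas that of the involution \<open>t\<close> is its own transpose.
\<close>

lemma low_le_conj_adj_lower:
  assumes "invol s" "invol t" "0 < i" "low_le s t" "t (Suc i) < t i"
  shows "low_le (conj_adj i s) t"
proof -
  have "low_le (s \<circ> adj i) t" using assms by (intro low_le_right_adj_lower)
  then have "low_le (adj i \<circ> s) t"
    unfolding low_le_def using low_count_swap_right_left[OF assms(1,3)] low_count_sym[OF assms(2)]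
    by metis
  then show ?thesis
    unfolding conj_adj_def using assms by (intro low_le_right_adj_lower)
qed

lemma low_le_conj_adj_upper:
  assumes "invol s" "invol t" "0 < i" "low_le s t" "s i < s (Suc i)"
  shows "low_le s (conj_adj i t)"
proof -
  have "low_le s (t \<circ> adj i)" using assms by (intro low_le_right_adj_upper)
  then have "low_le s (adj i \<circ> t)"
    unfolding low_le_def using low_count_swap_right_left[OF assms(2,3)] low_count_sym[OF assms(1)]
    by metis
  then show ?thesis
    unfolding conj_adj_def using assms by (intro low_le_right_adj_upper)
qed

lemma conj_adj_conj_adj [simp]: "conj_adj i (conj_adj i s) = s"
  by (auto simp: conj_adj_def fun_eq_iff)

lemma invol_conj_adj:
  assumes "invol s" "0 < i"
  shows "invol (conj_adj i s)"
proof -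
  have "adj i 0 = 0" using assms(2) by (simp add: transpose_def)
  then show ?thesis using invol_simps[OF assms(1)] unfolding invol_def conj_adj_def by simp
qed

lemma conj_adj_apply:
  "conj_adj i s i = adj i (s (Suc i))" "conj_adj i s (Suc i) = adj i (s i)"
  by (simp_all add: conj_adj_def)

text \<open>
  An adjacent transposition preserves the order of every pair except the one that it swaps. Hence
  conjugation turns an ascent into a descent and back, unless \<open>{i, i + 1}\<close> is stable under \<open>s\<close>.
\<close>

lemma adj_less:
  "x < y \<Longrightarrow> x \<noteq> i \<or> y \<noteq> Suc i \<Longrightarrow> adj i x < adj i y"
  by (auto simp: transpose_def)

lemma conj_adj_descent_of_ascent:
  assumes "s i < s (Suc i)" "s i \<noteq> i \<or> s (Suc i) \<noteq> Suc i"
  shows "conj_adj i s (Suc i) < conj_adj i s i"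
  unfolding conj_adj_apply by (rule adj_less) (use assms in auto)

lemma conj_adj_ascent_of_descent:
  assumes "s (Suc i) < s i" "s i \<noteq> Suc i"
  shows "conj_adj i s i < conj_adj i s (Suc i)"
  unfolding conj_adj_apply by (rule adj_less) (use assms in auto)

section \<open>Inversions\<close>

text \<open>
  Moving the positions of an inversion along \<open>adj i\<close> matches the inversions of \<open>s\<close> with those of
  \<open>s \<circ> adj i\<close> other than \<open>(i, i + 1)\<close>, since \<open>adj i\<close> keeps all other pairs in order.
\<close>

lemma inv_number_right_adj:
  assumes "0 < i" "i < n" "s i < s (Suc i)"
  shows "inv_number n (s \<circ> adj i) = inv_number n s + 1"
proof -
  define I where "I s = {(p, q). p \<in> {1..n} \<and> q \<in> {1..n} \<and> p < q \<and> s p > s q}" for s :: "nat \<Rightarrow> nat"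
  let ?t = "adj i"
  have range: "?t p \<in> {1..n} \<longleftrightarrow> p \<in> {1..n}" for p
    using assms(1,2) by (auto simp: transpose_def)
  have I_swap: "(?t p, ?t q) \<in> I s \<longleftrightarrow> (p, q) \<in> I (s \<circ> ?t)" if "(p, q) \<noteq> (i, Suc i)" "p < q" for p q
  proof -
    have "?t p < ?t q" using that by (intro adj_less) auto
    with that show ?thesis by (simp add: I_def range del: atLeastAtMost_iff One_nat_def)
  qed
  have I_swap': "(p, q) \<in> I s \<Longrightarrow> (?t p, ?t q) \<in> I (s \<circ> ?t)" for p q
  proof -
    assume pq: "(p, q) \<in> I s"
    then have "p < q" "(p, q) \<noteq> (i, Suc i)" using assms(3) by (auto simp: I_def)
    then have "?t p < ?t q" by (intro adj_less) auto
    with pq show ?thesis by (simp add: I_def range del: atLeastAtMost_iff One_nat_def)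
  qed
  have "I (s \<circ> ?t) = insert (i, Suc i) (map_prod ?t ?t ` I s)"
  proof (rule set_eqI, rule iffI)
    fix x assume x: "x \<in> I (s \<circ> ?t)"
    obtain p q where x_eq: "x = (p, q)" by (cases x)
    show "x \<in> insert (i, Suc i) (map_prod ?t ?t ` I s)"
    proof (cases "(p, q) = (i, Suc i)")
      case False
      have "p < q" using x by (simp add: x_eq I_def)
      with False x have "(?t p, ?t q) \<in> I s" by (simp add: I_swap x_eq)
      then have "map_prod ?t ?t (?t p, ?t q) \<in> map_prod ?t ?t ` I s" by (rule imageI)
      then show ?thesis by (simp add: x_eq)
    qed (simp add: x_eq)
  next
    fix x assume "x \<in> insert (i, Suc i) (map_prod ?t ?t ` I s)"
    then show "x \<in> I (s \<circ> ?t)"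
      using assms I_swap' by (auto simp: I_def[of "s \<circ> ?t"] I_def)
  qed
  moreover have "(i, Suc i) \<notin> map_prod ?t ?t ` I s"
  proof
    assume "(i, Suc i) \<in> map_prod ?t ?t ` I s"
    then obtain p q where pq: "(p, q) \<in> I s" "i = ?t p" "Suc i = ?t q" by auto
    then have "p = ?t i" "q = ?t (Suc i)" by (metis transpose_involutory)+
    then show False using pq by (simp add: I_def)
  qed
  moreover have "inj_on (map_prod ?t ?t) (I s)"
    by (rule inj_onI) (metis map_prod_simp prod.exhaust prod.inject transpose_involutory)
  moreover have "finite (I s)"
    by (rule finite_subset[of _ "{1..n} \<times> {1..n}"]) (auto simp: I_def)
  ultimately have "card (I (s \<circ> ?t)) = card (I s) + 1"
    by (simp add: card_image)
  then show ?thesis by (simp add: I_def inv_number_def)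
qed

lemma inv_number_inverse:
  assumes "s permutes {1..n}" "\<And>p. s (s' p) = p" "\<And>p. s' (s p) = p"
  shows "inv_number n s' = inv_number n s"
proof -
  have range: "s p \<in> {1..n} \<longleftrightarrow> p \<in> {1..n}" for p
    using assms(1) by (rule permutes_in_image)
  have range': "s' p \<in> {1..n} \<longleftrightarrow> p \<in> {1..n}" for p
    using range[of "s' p"] unfolding assms(2) by blast
  have "bij_betw (\<lambda>(p, q). (s q, s p))
     {(i, j). i \<in> {1..n} \<and> j \<in> {1..n} \<and> i < j \<and> s i > s j}
     {(i, j). i \<in> {1..n} \<and> j \<in> {1..n} \<and> i < j \<and> s' i > s' j}"
    by (rule bij_betwI[where g = "\<lambda>(p, q). (s' q, s' p)"])
       (auto simp: assms(2,3) range range' simp del: atLeastAtMost_iff One_nat_def)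
  then show ?thesis unfolding inv_number_def by (simp add: bij_betw_same_card)
qed

lemma inv_number_conj_adj:
  assumes "invol s" "s permutes {1..n}" "0 < i" "i < n" "s i < s (Suc i)"
    "s i \<noteq> i \<or> s (Suc i) \<noteq> Suc i"
  shows "inv_number n (conj_adj i s) = inv_number n s + 2"
proof -
  have perm: "(s \<circ> adj i) permutes {1..n}"
    using assms(2-4) by (intro permutes_compose permutes_swap_id) auto
  have "inv_number n (adj i \<circ> s) = inv_number n (s \<circ> adj i)"
    by (rule inv_number_inverse[OF perm]) (simp_all add: assms(1))
  also have "\<dots> = inv_number n s + 1"
    using assms by (intro inv_number_right_adj)
  finally have "inv_number n (adj i \<circ> s) = inv_number n s + 1" .
  moreover have "inv_number n (adj i \<circ> s \<circ> adj i) = inv_number n (adj i \<circ> s) + 1"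
    using assms adj_less[of "s i" "s (Suc i)" i] by (intro inv_number_right_adj) auto
  ultimately show ?thesis by (simp add: conj_adj_def)
qed

section \<open>Conjugation and counting in the classes\<close>

lemma invol_classD:
  assumes "s \<in> invol_class n a"
  shows "s permutes {1..n}" "invol s" "card {i \<in> {1..n}. s i = i} = a"
    and "s p \<in> {1..n} \<longleftrightarrow> p \<in> {1..n}" "p \<notin> {1..n} \<Longrightarrow> s p = p"
proof -
  show perm: "s permutes {1..n}" and "card {i \<in> {1..n}. s i = i} = a"
    using assms by (auto simp: invol_class_def)
  have "s \<circ> s = id" using assms by (simp add: invol_class_def)
  then have "s (s i) = i" for i by (rule pointfree_idE)
  moreover have "s 0 = 0" using permutes_not_in[OF perm, of 0] by simp
  ultimately show "invol s" unfolding invol_def by blast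
  show "s p \<in> {1..n} \<longleftrightarrow> p \<in> {1..n}" using perm by (rule permutes_in_image)
  show "p \<notin> {1..n} \<Longrightarrow> s p = p" using perm by (rule permutes_not_in)
qed

lemma invol_class_conjugate:
  assumes "s \<in> invol_class n a" "w permutes {1..n}" "\<And>p. w (w p) = p"
  shows "w \<circ> s \<circ> w \<in> invol_class n a"
proof -
  note s = invol_classD[OF assms(1)]
  have "(w \<circ> s \<circ> w) permutes {1..n}"
    using s(1) assms(2) by (intro permutes_compose)
  moreover have "(w \<circ> s \<circ> w) \<circ> (w \<circ> s \<circ> w) = id"
    by (simp add: fun_eq_iff assms(3) s(2))
  moreover have "bij_betw w {i \<in> {1..n}. s i = i} {i \<in> {1..n}. (w \<circ> s \<circ> w) i = i}"
  proof (rule bij_betwI[where g = w])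
    have range: "w p \<in> {1..n} \<longleftrightarrow> p \<in> {1..n}" for p
      using assms(2) by (rule permutes_in_image)
    show "w \<in> {i \<in> {1..n}. s i = i} \<rightarrow> {i \<in> {1..n}. (w \<circ> s \<circ> w) i = i}"
      by (auto simp: range assms(3) simp del: atLeastAtMost_iff One_nat_def)
    show "w \<in> {i \<in> {1..n}. (w \<circ> s \<circ> w) i = i} \<rightarrow> {i \<in> {1..n}. s i = i}"
    proof
      fix i assume "i \<in> {i \<in> {1..n}. (w \<circ> s \<circ> w) i = i}"
      then have i: "i \<in> {1..n}" "w (s (w i)) = i" by auto
      then have "s (w i) = w i" by (metis assms(3))
      with i show "w i \<in> {i \<in> {1..n}. s i = i}" by (simp add: range del: atLeastAtMost_iff One_nat_def)
    qed
  qed (simp_all add: assms(3))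
  ultimately show ?thesis
    using s(3) bij_betw_same_card unfolding invol_class_def by fastforce
qed

lemma conj_adj_in_class:
  assumes "s \<in> invol_class n a" "0 < i" "i < n"
  shows "conj_adj i s \<in> invol_class n a"
  unfolding conj_adj_def
  by (rule invol_class_conjugate[OF assms(1)]) (use assms in \<open>auto intro: permutes_swap_id\<close>)

lemma finite_invol_class: "finite (invol_class n a)"
  by (rule finite_subset[OF _ finite_permutations[of "{1..n}"]]) (auto simp: invol_class_def)

text \<open>
  The points of \<open>{1..k}\<close> that stay in \<open>{1..k}\<close> are fixed points and two-cycles. In particular the
  parity of a diagonal entry tells the parity of the number of fixed points up to \<open>k\<close>.
\<close>

lemma low_count_diag:
  assumes "invol s"
  shows "low_count s k k = card {p \<in> {1..k}. s p = p} + 2 * card {p \<in> {1..k}. p < s p \<and> s p \<le> k}"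
proof -
  let ?F = "{p \<in> {1..k}. s p = p}" and ?U = "{p \<in> {1..k}. p < s p \<and> s p \<le> k}"
    and ?D = "{p \<in> {1..k}. s p < p}"
  have pos: "1 \<le> s p \<longleftrightarrow> 1 \<le> p" for p
    using invol_pos_iff[OF assms, of p] by linarith
  have "bij_betw s ?U ?D"
  proof (rule bij_betwI[where g = s])
    show "s \<in> ?U \<rightarrow> ?D" using pos by (auto simp: assms)
    show "s \<in> ?D \<rightarrow> ?U" using pos by (auto simp: assms)
  qed (simp_all add: assms)
  then have "card ?D = card ?U" by (simp add: bij_betw_same_card)
  moreover have "{p \<in> {1..k}. s p \<le> k} = ?F \<union> (?U \<union> ?D)" by auto
  moreover have "card (?F \<union> (?U \<union> ?D)) = card ?F + card (?U \<union> ?D)"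
    by (rule card_Un_disjoint) auto
  moreover have "card (?U \<union> ?D) = card ?U + card ?D"
    by (rule card_Un_disjoint) auto
  ultimately show ?thesis by (simp add: low_count_def)
qed

lemma low_count_diag_parity:
  "invol s \<Longrightarrow> even (low_count s k k) \<longleftrightarrow> even (card {p \<in> {1..k}. s p = p})"
  by (simp add: low_count_diag)

lemma invol_class_size:
  assumes "s \<in> invol_class n a"
  shows "n = a + 2 * card {p \<in> {1..n}. p < s p}"
proof -
  note s = invol_classD[OF assms]
  have "{p \<in> {1..n}. p < s p \<and> s p \<le> n} = {p \<in> {1..n}. p < s p}"
    using s(4) by auto
  then show ?thesis
    using low_count_diag[OF s(2), of n] low_count_permutes_outside[OF s(1), of n n] s(3) by simp
qed

section \<open>Proper descents\<close>

definition proper_descent :: "nat \<Rightarrow> (nat \<Rightarrow> nat) \<Rightarrow> nat \<Rightarrow> bool" where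
  "proper_descent n s i \<longleftrightarrow> 0 < i \<and> i < n \<and> s (Suc i) < s i \<and> s i \<noteq> Suc i"

text \<open>
  If \<open>s p \<ge> p + 2\<close>, then \<open>p\<close> is not the opening point of a two-cycle \<open>(p, p + 1)\<close>. So either it is a
  proper descent, or \<open>s (p + 1) > s p\<close> and the next point is again sent at least two places up.
\<close>

lemma long_arc_propagates:
  assumes "s \<in> invol_class n a" "0 < j" "j + 2 \<le> s j"
    "\<And>q. j \<le> q \<Longrightarrow> q < m \<Longrightarrow> \<not> proper_descent n s q"
    "j \<le> p" "p \<le> m"
  shows "p + 2 \<le> s p"
  using assms(5,6)
proof (induction p rule: dec_induct)
  case base
  show ?case by (rule assms(3))
next
  case (step p)
  note s = invol_classD[OF assms(1)]
  have long: "p + 2 \<le> s p" using step by simp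
  have "p \<in> {1..n}" using s(5)[of p] long by (metis add_le_same_cancel1 not_numeral_le_zero)
  then have "p < n" using s(4)[of p] long by auto
  then have "s p \<le> s (Suc p)"
    using assms(4)[of p] long step assms(2) by (auto simp: proper_descent_def)
  moreover have "s p \<noteq> s (Suc p)" using invol_eq_iff[OF s(2)] by simp
  ultimately show ?case using long by simp
qed

text \<open>
  Otherwise long arcs would propagate up to \<open>n\<close>, which cannot be sent beyond \<open>n\<close>.
\<close>

lemma short_arcs_if_no_proper_descent:
  assumes "s \<in> invol_class n a" "\<And>i. \<not> proper_descent n s i"
  shows "s p \<le> Suc p"
proof (rule ccontr)
  assume "\<not> ?thesis"
  then have long: "p + 2 \<le> s p" by simp
  note s = invol_classD[OF assms(1)]
  have p: "p \<in> {1..n}" using s(5)[of p] long by (metis add_le_same_cancel1 not_numeral_le_zero)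
  then have "n + 2 \<le> s n"
    using long_arc_propagates[OF assms(1) _ long, of n n] assms(2) by simp
  moreover have "s n \<in> {1..n}" using s(4)[of n] p by simp
  ultimately show False by simp
qed

lemma inv_number_if_no_proper_descent:
  assumes "s \<in> invol_class n a" "\<And>i. \<not> proper_descent n s i"
  shows "n = a + 2 * inv_number n s"
proof -
  note s = invol_classD[OF assms(1)]
  have up: "s p \<le> Suc p" for p by (rule short_arcs_if_no_proper_descent[OF assms])
  have down: "p \<le> Suc (s p)" for p using up[of "s p"] by (simp add: s(2))
  have "{(i, j). i \<in> {1..n} \<and> j \<in> {1..n} \<and> i < j \<and> s i > s j}
        = (\<lambda>p. (p, Suc p)) ` {p \<in> {1..n}. p < s p}" (is "?L = ?R")
  proof
    show "?L \<subseteq> ?R"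
    proof
      fix x assume "x \<in> ?L"
      then obtain i j where x: "x = (i, j)" "i \<in> {1..n}" "i < j" "s j < s i" by auto
      then have "j = Suc i" "i < s i" using up[of i] down[of j] by auto
      with x show "x \<in> ?R" by simp
    qed
    show "?R \<subseteq> ?L"
    proof
      fix x assume "x \<in> ?R"
      then obtain p where p: "x = (p, Suc p)" "p \<in> {1..n}" "p < s p" by auto
      then have "s p = Suc p" using up[of p] by simp
      moreover from this have "s (Suc p) = p" using s(2) by (metis invol_simps(1))
      ultimately show "x \<in> ?L" using p s(4)[of p] by auto
    qed
  qed
  then have "inv_number n s = card {p \<in> {1..n}. p < s p}"
    unfolding inv_number_def by (simp add: card_image inj_on_def)
  then show ?thesis using invol_class_size[OF assms(1)] by simp
qed

lemma low_le_preserves_cut: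
  assumes "low_le s t" "\<And>i. 1 \<le> i \<Longrightarrow> i \<le> k \<Longrightarrow> t i \<le> k" "1 \<le> i" "i \<le> k"
  shows "s i \<le> k"
proof -
  have "low_count t k k = k" using assms(2) by (simp add: low_count_eq_full_iff)
  then have "low_count s k k = k"
    using assms(1) low_count_le[of s k k] unfolding low_le_def by (metis le_antisym)
  then show ?thesis using assms(3,4) by (simp add: low_count_eq_full_iff)
qed

lemma low_le_preserves_cut_above:
  assumes "invol s" "low_le s t" "\<And>i. 1 \<le> i \<Longrightarrow> i < p \<Longrightarrow> t i < p" "1 \<le> p"
  shows "p \<le> s p"
proof (rule ccontr)
  assume "\<not> p \<le> s p"
  moreover have "1 \<le> s p" using invol_pos_iff[OF assms(1), of p] assms(4) by simp
  moreover have "t i \<le> p - 1" if "1 \<le> i" "i \<le> p - 1" for i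
    using assms(3)[of i] that by linarith
  ultimately have "s (s p) \<le> p - 1"
    using low_le_preserves_cut[OF assms(2), of "p - 1" "s p"] by simp
  then show False using assms(1,4) by simp
qed

text \<open>
  Below \<open>g\<close> no arc of \<open>t\<close> reaches beyond the next point, so \<open>t\<close> preserves the cuts on both sides of its
  fixed point \<open>g\<close>. Everything below \<open>t\<close> preserves them, too.
\<close>

lemma low_le_fixed_point:
  assumes "invol s" "invol t" "low_le s t" "\<And>k. 0 < k \<Longrightarrow> k < g \<Longrightarrow> t k \<le> Suc k" "t g = g" "0 < g"
  shows "s g = g"
proof -
  have below: "t i < g" if "1 \<le> i" "i < g" for i
  proof -
    have "t i \<noteq> g" using that assms(2,5) invol_eq_iff[OF assms(2), of i g] by auto
    then show ?thesis using assms(4)[of i] that by simp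
  qed
  have upto: "t i \<le> g" if "1 \<le> i" "i \<le> g" for i
    using below[of i] that assms(5) by (cases "i = g") auto
  have g: "1 \<le> g" using assms(6) by simp
  have "s g \<le> g" by (rule low_le_preserves_cut[OF assms(3) upto g order_refl])
  moreover have "g \<le> s g" by (rule low_le_preserves_cut_above[OF assms(1,3) below g])
  ultimately show ?thesis by simp
qed

text \<open>
  All cuts outside of the two-cycles of \<open>t\<close> are inherited by \<open>s\<close>, so \<open>s\<close> arises from \<open>t\<close> by dissolving
  some of its two-cycles. Having as many fixed points as \<open>t\<close>, it dissolves none.
\<close>

lemma minimal_if_no_proper_descent:
  assumes s: "s \<in> invol_class n a" and t: "t \<in> invol_class n a" and le: "low_le s t"
    and no: "\<And>i. \<not> proper_descent n t i"
  shows "s = t"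
proof -
  note sD = invol_classD[OF s] and tD = invol_classD[OF t]
  have up: "t p \<le> Suc p" for p by (rule short_arcs_if_no_proper_descent[OF t no])
  have "{i \<in> {1..n}. t i = i} \<subseteq> {i \<in> {1..n}. s i = i}"
    using low_le_fixed_point[OF sD(2) tD(2) le] up by auto
  then have fixed_eq: "{i \<in> {1..n}. t i = i} = {i \<in> {1..n}. s i = i}"
    using sD(3) tD(3) by (intro card_subset_eq) auto
  have opener: "s p = Suc p" if "t p = Suc p" "p \<in> {1..n}" for p
  proof -
    have tSuc: "t (Suc p) = p" using that tD(2) by (metis invol_simps(1))
    have below: "t i < p" if "1 \<le> i" "i < p" for i
    proof -
      have "t i \<noteq> t (Suc p)" using that invol_eq_iff[OF tD(2), of i "Suc p"] by auto
      then show ?thesis using up[of i] that tSuc by simp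
    qed
    have upto: "t i \<le> Suc p" if "1 \<le> i" "i \<le> Suc p" for i
      using up[of i] that tSuc by (cases "i = Suc p") auto
    have p: "1 \<le> p" "p \<le> Suc p" using that by simp_all
    have "s p \<le> Suc p" by (rule low_le_preserves_cut[OF le upto p])
    moreover have "p \<le> s p" by (rule low_le_preserves_cut_above[OF sD(2) le below p(1)])
    moreover have "s p \<noteq> p"
    proof
      assume "s p = p"
      then have "p \<in> {i \<in> {1..n}. t i = i}" unfolding fixed_eq using that by blast
      then show False using that by simp
    qed
    ultimately show ?thesis by simp
  qed
  show ?thesis
  proof
    fix p
    show "s p = t p"
    proof (cases "p \<in> {1..n}")
      case p: True
      consider "t p = p" | "t p = Suc p" | "t p < p" using up[of p] by linarith
      then show ?thesis
      proof cases
        case 1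
        then show ?thesis using fixed_eq p by auto
      next
        case 2
        then show ?thesis using opener p by simp
      next
        case 3
        have "t (t p) \<le> Suc (t p)" by (rule up)
        then have "t (t p) = Suc (t p)" "p = Suc (t p)" using 3 tD(2) by auto
        moreover have "t p \<in> {1..n}" using tD(4) p by simp
        ultimately have "s (t p) = p" using opener by metis
        then show ?thesis using sD(2) by (metis invol_simps(1))
      qed
    next
      case False
      then show ?thesis using sD(5) tD(5) by simp
    qed
  qed
qed

section \<open>Descents where the lower involution has a two-cycle\<close>

text \<open>
  The table of the conjugate of \<open>t\<close> differs from that of \<open>t\<close> in row and column \<open>i\<close> only. In a column
  \<open>l < i\<close> the rows \<open>i - 1\<close>, \<open>i\<close> and \<open>i + 1\<close> of \<open>s\<close> agree, so the bound in row \<open>i + 1\<close> carries over; in a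
  column \<open>l > i\<close> row \<open>i\<close> of \<open>s\<close> exceeds row \<open>i - 1\<close> by one, as much as it ever can. At \<open>(i, i)\<close> the conjugate can exceed \<open>M\<^sub>t(i - 1, i - 1)\<close>
  by \<open>2\<close>, and then \<open>M\<^sub>t(i - 1, i - 1) < M\<^sub>s(i - 1, i - 1)\<close>; equal parities widen this gap to \<open>2\<close>.
\<close>

lemma low_le_conj_adj_upper_if_swapped:
  assumes s: "invol s" and t: "invol t" and i: "0 < i" and le: "low_le s t"
    and desc: "t (Suc i) < t i" "t i \<noteq> Suc i" and swap: "s i = Suc i"
    and not_fixed: "t (Suc i) \<noteq> Suc i"
    and parity: "even (low_count s (i - 1) (i - 1)) \<longleftrightarrow> even (low_count t (i - 1) (i - 1))"
  shows "low_le s (conj_adj i t)"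
proof -
  let ?t = "conj_adj i t"
  have t': "invol ?t" using t i by (rule invol_conj_adj)
  have sSuc: "s (Suc i) = i" using swap s by (metis invol_simps(1))
  have rows: "low_count t k l \<le> low_count s k l" for k l using le by (simp add: low_le_def)
  have adj_le: "adj i x \<le> l \<longleftrightarrow> x \<le> l" if "l \<noteq> i" for x l
    using that by (auto simp: transpose_def)
  have col: "low_count ?t k l = low_count (t \<circ> adj i) k l" if "l \<noteq> i" for k l
    by (rule low_count_cong) (simp add: conj_adj_def adj_le[OF that])
  have row_i: "low_count ?t i l \<le> low_count s i l" if "l \<noteq> i" for l
  proof -
    have "low_count ?t i l = low_count t (i - 1) l + (if t (Suc i) \<le> l then 1 else 0)"
      by (simp only: col[OF that] low_count_right_adj[OF i] if_True simp_thms)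
    moreover have "low_count s i l = low_count s (i - 1) l + (if Suc i \<le> l then 1 else 0)"
      by (simp only: low_count_pos[OF i] swap)
    moreover have "low_count s (Suc i) l = low_count s i l + (if i \<le> l then 1 else 0)"
      by (simp only: low_count_Suc sSuc)
    moreover have "low_count t (Suc i) l =
        low_count t (i - 1) l + (if t i \<le> l then 1 else 0) + (if t (Suc i) \<le> l then 1 else 0)"
      by (simp only: low_count_Suc low_count_pos[OF i])
    ultimately show ?thesis
      using rows[of "i - 1" l] rows[of "Suc i" l] desc(1) that by (simp split: if_splits)
  qed
  have corner: "low_count ?t i i \<le> low_count s i i"
  proof -
    let ?m = "low_count s (i - 1) (i - 1)" and ?m' = "low_count t (i - 1) (i - 1)"
    have "t (Suc i) \<noteq> i" using desc(2) t by (metis invol_simps(1))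
    then have t'i: "?t i = t (Suc i)" using not_fixed by (simp add: conj_adj_apply)
    have "low_count ?t i i = low_count ?t (i - 1) i + (if t (Suc i) \<le> i then 1 else 0)"
      using low_count_pos[OF i, of ?t i] t'i by simp
    also have "low_count ?t (i - 1) i = low_count ?t i (i - 1)"
      by (rule low_count_sym[OF t'])
    also have "\<dots> = ?m' + (if t (Suc i) \<le> i - 1 then 1 else 0)"
      using i by (simp add: col low_count_right_adj)
    finally have eq: "low_count ?t i i = ?m' + (if t (Suc i) < i then 2 else 0)"
      using \<open>t (Suc i) \<noteq> i\<close> i by auto
    have "low_count s i i = low_count s (i - 1) i"
      using low_count_pos[OF i, of s i] swap by simp
    also have "\<dots> = low_count s i (i - 1)" by (rule low_count_sym[OF s])
    also have "\<dots> = ?m" using low_count_pos[OF i, of s "i - 1"] swap by simp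
    finally have eq_s: "low_count s i i = ?m" .
    show ?thesis
    proof (cases "t (Suc i) < i")
      case True
      \<comment> \<open>The column \<open>i - 1\<close> shows that \<open>?m' = ?m\<close> is impossible: there \<open>t\<close> gains a point between rows
        \<open>i - 1\<close> and \<open>i + 1\<close>, and \<open>s\<close> gains none.\<close>
      have "low_count s (Suc i) (i - 1) = ?m"
        using low_count_pos[OF i, of s "i - 1"] swap sSuc i by (simp add: low_count_Suc)
      moreover have "?m' + 1 \<le> low_count t (Suc i) (i - 1)"
        using low_count_pos[OF i, of t "i - 1"] True by (simp add: low_count_Suc)
      ultimately have "?m' < ?m" using rows[of "Suc i" "i - 1"] by simp
      moreover have "x + 2 \<le> y" if "even y \<longleftrightarrow> even x" "x < y" for x y :: nat
        using that by presburger
      ultimately have "?m' + 2 \<le> ?m" using parity by blast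
      then show ?thesis using eq eq_s True by simp
    next
      case False
      then show ?thesis using eq eq_s rows[of "i - 1" "i - 1"] by simp
    qed
  qed
  show ?thesis
    unfolding low_le_def
  proof (intro allI)
    fix k l
    consider "k = i" "l = i" | "k = i" "l \<noteq> i" | "k \<noteq> i" "l = i" | "k \<noteq> i" "l \<noteq> i" by blast
    then show "low_count ?t k l \<le> low_count s k l"
    proof cases
      case 3
      then show ?thesis using row_i[of k] low_count_sym[OF s] low_count_sym[OF t'] by metis
    next
      case 4
      then show ?thesis using rows[of k l] by (simp add: col low_count_right_adj[OF i])
    qed (use corner row_i in simp_all)
  qed
qed

section \<open>The symmetry induced by the longest element\<close>

text \<open>
  Conjugation by this permutation is an automorphism of each class. It moves descents from \<open>i\<close> to
  \<open>n - i\<close> and thus exchanges the two possible orders of the fixed points of \<open>s\<close> and \<open>t\<close>.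
\<close>

definition reversal :: "nat \<Rightarrow> nat \<Rightarrow> nat" where
  "reversal n p = (if p \<in> {1..n} then Suc n - p else p)"

lemma reversal_reversal [simp]: "reversal n (reversal n p) = p"
  by (auto simp: reversal_def)

lemma reversal_in_iff: "reversal n p \<in> {1..n} \<longleftrightarrow> p \<in> {1..n}"
  by (auto simp: reversal_def)

lemma reversal_permutes: "reversal n permutes {1..n}"
proof -
  have "bij_betw (reversal n) {1..n} {1..n}"
    by (rule bij_betwI[where g = "reversal n"]) (auto simp: reversal_in_iff simp del: atLeastAtMost_iff One_nat_def)
  then show ?thesis by (rule bij_imp_permutes) (auto simp: reversal_def)
qed

definition reverse_conj :: "nat \<Rightarrow> (nat \<Rightarrow> nat) \<Rightarrow> nat \<Rightarrow> nat" where
  "reverse_conj n s = reversal n \<circ> s \<circ> reversal n"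

lemma reverse_conj_reverse_conj [simp]: "reverse_conj n (reverse_conj n s) = s"
  by (simp add: reverse_conj_def fun_eq_iff)

lemma reverse_conj_in_class:
  "s \<in> invol_class n a \<Longrightarrow> reverse_conj n s \<in> invol_class n a"
  unfolding reverse_conj_def by (rule invol_class_conjugate) (simp_all add: reversal_permutes del: One_nat_def)

text \<open>
  Inclusion and exclusion: the complements of \<open>k\<close> positions and \<open>l\<close> values correspond under the
  reversal to the first \<open>n - k\<close> positions and the first \<open>n - l\<close> values.
\<close>

lemma low_count_reverse_conj:
  assumes "s permutes {1..n}" "k \<le> n" "l \<le> n"
  shows "low_count (reverse_conj n s) k l + n = k + l + low_count s (n - k) (n - l)"
proof -
  have range: "s p \<in> {1..n} \<longleftrightarrow> p \<in> {1..n}" for p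
    using assms(1) by (rule permutes_in_image)
  let ?A = "{q \<in> {n - k<..n}. n - l < s q}" and ?B = "{q \<in> {n - k<..n}. s q \<le> n - l}"
  have "bij_betw (reversal n) {p \<in> {1..k}. reverse_conj n s p \<le> l} ?A"
  proof (rule bij_betwI[where g = "reversal n"])
    show "reversal n \<in> {p \<in> {1..k}. reverse_conj n s p \<le> l} \<rightarrow> ?A"
    proof
      fix p assume "p \<in> {p \<in> {1..k}. reverse_conj n s p \<le> l}"
      then have p: "1 \<le> p" "p \<le> k" "reversal n (s (reversal n p)) \<le> l"
        by (auto simp: reverse_conj_def)
      have "s (reversal n p) \<in> {1..n}"
        using p assms(2) by (simp only: range reversal_in_iff) simp
      with p assms(2,3) show "reversal n p \<in> ?A"
        by (auto simp: reversal_def split: if_splits)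
    qed
    show "reversal n \<in> ?A \<rightarrow> {p \<in> {1..k}. reverse_conj n s p \<le> l}"
    proof
      fix q assume q: "q \<in> ?A"
      then have "s q \<in> {1..n}" by (subst range) auto
      with q assms(2,3) show "reversal n q \<in> {p \<in> {1..k}. reverse_conj n s p \<le> l}"
        by (auto simp: reversal_def reverse_conj_def)
    qed
  qed simp_all
  then have "low_count (reverse_conj n s) k l = card ?A"
    unfolding low_count_def by (rule bij_betw_same_card)
  moreover have "card {n - k<..n} = card ?A + card ?B"
  proof -
    have "{n - k<..n} = ?A \<union> ?B" by auto
    then have "card {n - k<..n} = card (?A \<union> ?B)" by (rule arg_cong)
    also have "\<dots> = card ?A + card ?B" by (rule card_Un_disjoint) auto
    finally show ?thesis .
  qed
  moreover have "low_count s n (n - l) = low_count s (n - k) (n - l) + card ?B"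
  proof -
    have "{i \<in> {1..n}. s i \<le> n - l} = {i \<in> {1..n - k}. s i \<le> n - l} \<union> ?B" by auto
    then show ?thesis unfolding low_count_def by (simp add: card_Un_disjoint disjoint_iff)
  qed
  moreover have "low_count s n (n - l) = n - l"
    using low_count_permutes_outside[OF assms(1), of n "n - l"] by simp
  moreover have "card {n - k<..n} = k" using assms(2) by simp
  ultimately show ?thesis using assms(2,3) by linarith
qed

lemma low_le_reverse_conj:
  assumes "s permutes {1..n}" "t permutes {1..n}" "low_le s t"
  shows "low_le (reverse_conj n s) (reverse_conj n t)"
  unfolding low_le_def
proof (intro allI)
  fix k l
  have perm: "reverse_conj n s permutes {1..n}" "reverse_conj n t permutes {1..n}"
    unfolding reverse_conj_def by (intro permutes_compose reversal_permutes assms)+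
  show "low_count (reverse_conj n t) k l \<le> low_count (reverse_conj n s) k l"
  proof (cases "k \<le> n \<and> l \<le> n")
    case True
    have "low_count t (n - k) (n - l) \<le> low_count s (n - k) (n - l)"
      using assms(3) by (simp add: low_le_def)
    then show ?thesis
      using True low_count_reverse_conj[OF assms(1), of k l] low_count_reverse_conj[OF assms(2), of k l]
      by simp
  next
    case False
    then show ?thesis
      using low_count_permutes_outside[OF perm(1), of k l]
            low_count_permutes_outside[OF perm(2), of k l] by auto
  qed
qed

lemma reverse_conj_conj_adj:
  assumes "0 < i" "i < n"
  shows "conj_adj i (reverse_conj n s) = reverse_conj n (conj_adj (n - i) s)"
proof -
  have left: "adj i (reversal n x) = reversal n (adj (n - i) x)" for x
    using assms by (auto simp: reversal_def transpose_def)
  have right: "reversal n (adj i x) = adj (n - i) (reversal n x)" for x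
    using left[of "reversal n x"] by (metis reversal_reversal)
  show ?thesis
    by (simp add: conj_adj_def reverse_conj_def fun_eq_iff left right)
qed

section \<open>Covers among involutions with at most one fixed point\<close>

text \<open>
  The fixed point \<open>f\<close> and the two-cycle \<open>(i, i + 1)\<close> are replaced by the two-cycle \<open>(f, i + 1)\<close> and the
  fixed point \<open>i\<close>. The counts drop by one on the square \<open>[f, i]\<^sup>2\<close> without its corner \<open>(i, i)\<close>.
\<close>

lemma low_count_move_fixed_point:
  assumes "s f = f" "s i = Suc i" "s (Suc i) = i" "0 < f" "f < i"
  shows "low_count s k l = low_count (s(f := Suc i, i := i, Suc i := f)) k l +
    (if f \<le> k \<and> f \<le> l \<and> k \<le> i \<and> l \<le> i \<and> (k < i \<or> l < i) then 1 else 0)"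
  using assms by (induction k) (auto simp: low_count_Suc)

lemma move_fixed_point_eq_conjugate:
  assumes "invol s" "s f = f" "s i = Suc i" "f < i"
  shows "s(f := Suc i, i := i, Suc i := f) = transpose f i \<circ> s \<circ> transpose f i"
proof
  fix p
  have "s (Suc i) = i" using assms by (metis invol_simps(1))
  moreover have "s p \<noteq> f" "s p \<noteq> i" if "p \<noteq> f" "p \<noteq> i" "p \<noteq> Suc i"
    using that assms(1-3) by (metis invol_simps(1))+
  ultimately show "(s(f := Suc i, i := i, Suc i := f)) p = (transpose f i \<circ> s \<circ> transpose f i) p"
    using assms by (auto simp: transpose_def)
qed

text \<open>
  The situation in which the induction on covers cannot conjugate anything: at every proper descent of
  \<open>t\<close> the involution \<open>s\<close> has a two-cycle, and it is not below the conjugate of \<open>t\<close>.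
\<close>

definition stuck :: "nat \<Rightarrow> (nat \<Rightarrow> nat) \<Rightarrow> (nat \<Rightarrow> nat) \<Rightarrow> bool" where
  "stuck n s t \<longleftrightarrow>
     (\<forall>i. proper_descent n t i \<longrightarrow> s i = Suc i \<and> \<not> low_le s (conj_adj i t))"

text \<open>
  Let \<open>i\<close> be the first proper descent of \<open>t\<close>, and \<open>j\<close> the first point that \<open>t\<close> sends at least two
  places up. Up to \<open>j - 1\<close> both involutions stay within \<open>{1..j - 1}\<close>, and from \<open>j\<close> up to \<open>i\<close> all points
  are sent by \<open>t\<close> beyond \<open>i\<close>. Thus \<open>M\<^sub>t \<le> j - 1\<close> on \<open>[1, i]\<^sup>2\<close>. The parity argument places the fixed
  point \<open>f\<close> of \<open>s\<close> between \<open>j\<close> and \<open>i\<close>, which forces \<open>M\<^sub>s \<ge> j\<close> on \<open>[f, i]\<^sup>2\<close>. So there is room to move the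
  fixed point of \<open>s\<close> from \<open>f\<close> to \<open>i\<close>.
\<close>

lemma between_if_stuck_left:
  assumes s: "s \<in> invol_class n 1" and t: "t \<in> invol_class n 1" and le: "low_le s t" and "s \<noteq> t"
    and stuck: "stuck n s t"
    and sf: "s f = f" "f \<in> {1..n}" and tg: "t g = g" "g \<in> {1..n}" and "f < g"
  shows "\<exists>r \<in> invol_class n 1. r \<noteq> s \<and> r \<noteq> t \<and> low_le s r \<and> low_le r t"
proof -
  note sD = invol_classD[OF s] and tD = invol_classD[OF t]
  have s_fixed: "p = f" if "s p = p" "p \<in> {1..n}" for p
    using that sf sD(3) by (metis (mono_tags, lifting) card_1_singletonE mem_Collect_eq singletonD)
  have t_fixed: "p = g" if "t p = p" "p \<in> {1..n}" for p
    using that tg tD(3) by (metis (mono_tags, lifting) card_1_singletonE mem_Collect_eq singletonD)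
  have descents: "s i = Suc i \<and> f < i" if desc: "proper_descent n t i" for i
  proof -
    have i: "0 < i" "i < n" "t (Suc i) < t i" "t i \<noteq> Suc i"
      using desc by (auto simp: proper_descent_def)
    have si: "s i = Suc i" and not_le: "\<not> low_le s (conj_adj i t)"
      using stuck desc by (auto simp: stuck_def)
    have sSuc: "s (Suc i) = i" using si sD(2) by (metis invol_simps(1))
    have "f < i"
    proof (rule ccontr)
      \<comment> \<open>Otherwise both fixed points lie beyond \<open>i + 1\<close>, and the counts at \<open>(i - 1, i - 1)\<close> are even.\<close>
      assume "\<not> f < i"
      then have fi: "Suc i < f" using si sSuc sf
        by (metis Suc_lessI less_not_refl2 lessI linorder_neqE_nat)
      have no_fixed: "{p \<in> {1..i - 1}. s p = p} = {}" "{p \<in> {1..i - 1}. t p = p} = {}"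
        using s_fixed t_fixed fi i \<open>f < g\<close> by fastforce+
      have "even (low_count s (i - 1) (i - 1))" "even (low_count t (i - 1) (i - 1))"
        unfolding low_count_diag_parity[OF sD(2)] low_count_diag_parity[OF tD(2)] no_fixed by simp_all
      moreover have "t (Suc i) \<noteq> Suc i" using t_fixed[of "Suc i"] fi i \<open>f < g\<close> by auto
      ultimately have "low_le s (conj_adj i t)"
        using i si by (intro low_le_conj_adj_upper_if_swapped sD tD le) auto
      with not_le show False ..
    qed
    with si show ?thesis by simp
  qed
  have "\<exists>i. proper_descent n t i"
    using minimal_if_no_proper_descent[OF s t le] \<open>s \<noteq> t\<close> by blast
  define i where "i = (LEAST i. proper_descent n t i)"
  have i_desc: "proper_descent n t i"
    unfolding i_def by (rule LeastI_ex) fact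
  have i_least: "\<not> proper_descent n t q" if "q < i" for q
    using that unfolding i_def by (rule not_less_Least)
  have i: "0 < i" "i < n" "t (Suc i) < t i" "t i \<noteq> Suc i"
    using i_desc by (auto simp: proper_descent_def)
  have si: "s i = Suc i" and "f < i" using descents[OF i_desc] by auto
  have sSuc: "s (Suc i) = i" using si sD(2) by (metis invol_simps(1))
  \<comment> \<open>If \<open>i\<close> itself is not sent far up, then \<open>t (i + 1) < i\<close>, and the arc from \<open>t (i + 1)\<close> to \<open>i + 1\<close>
    is long.\<close>
  have "\<exists>j. 0 < j \<and> j \<le> i \<and> j + 2 \<le> t j"
  proof (rule ccontr)
    assume none: "\<not> ?thesis"
    then have "t i \<le> i" using i by (metis add_2_eq_Suc' le_SucE not_less_eq_eq order_refl)
    let ?x = "t (Suc i)"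
    have "?x < i" "0 < ?x" using i \<open>t i \<le> i\<close> tD(2) by auto
    moreover have "t ?x = Suc i" using tD(2) by simp
    ultimately show False using none by (metis Suc_leI add_2_eq_Suc' less_imp_le_nat not_less_eq_eq)
  qed
  then have ex: "\<exists>j. 0 < j \<and> j + 2 \<le> t j" and le_i: "\<exists>j \<le> i. 0 < j \<and> j + 2 \<le> t j" by blast+
  define j where "j = (LEAST j. 0 < j \<and> j + 2 \<le> t j)"
  have j: "0 < j" "j + 2 \<le> t j"
    using LeastI_ex[OF ex] by (auto simp: j_def)
  have j_least: "t q \<le> Suc q" if "0 < q" "q < j" for q
  proof -
    have "\<not> (0 < q \<and> q + 2 \<le> t q)" using that(2) unfolding j_def by (rule not_less_Least)
    then show ?thesis using that(1) by simp
  qed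
  have "j \<le> i"
  proof -
    obtain j' where j': "j' \<le> i" "0 < j' \<and> j' + 2 \<le> t j'" using le_i by blast
    have "j \<le> j'" unfolding j_def using j'(2) by (rule Least_le)
    with j'(1) show ?thesis by simp
  qed
  have long: "p + 2 \<le> t p" if "j \<le> p" "p \<le> i" for p
    using long_arc_propagates[OF t j(1) j(2) _ that] i_least by blast
  have beyond: "i < t p" if "j \<le> p" "p \<le> i" for p
  proof (rule ccontr)
    assume "\<not> i < t p"
    then have "t p + 2 \<le> t (t p)" using long[OF that] that by (intro long) auto
    then show False using long[OF that] tD(2) by simp
  qed
  have t_cut: "t p \<le> j - 1" if "1 \<le> p" "p \<le> j - 1" for p
  proof -
    have "t p \<noteq> j"
    proof
      assume "t p = j"
      then have "t j = p" using tD(2) by (metis invol_simps(1))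
      then show False using j that by simp
    qed
    then show ?thesis using j_least[of p] that by linarith
  qed
  have s_cut: "s p \<le> j - 1" if "1 \<le> p" "p \<le> j - 1" for p
    by (rule low_le_preserves_cut[OF le t_cut that])
  have "j \<le> f"
  proof (rule ccontr)
    \<comment> \<open>Comparing parities on \<open>{1..j - 1}\<close>, the fixed point of \<open>t\<close> is below \<open>j\<close> as well. There \<open>t\<close> has
      short arcs only, so \<open>s\<close> has the same fixed point.\<close>
    assume "\<not> j \<le> f"
    have full: "low_count s (j - 1) (j - 1) = low_count t (j - 1) (j - 1)"
      using s_cut t_cut low_count_eq_full_iff by metis
    have inside: "p \<in> {1..n}" if "p \<in> {1..j - 1}" for p
      using that \<open>j \<le> i\<close> i(2) unfolding atLeastAtMost_iff by linarith
    have "f \<in> {1..j - 1}" using sf(2) \<open>\<not> j \<le> f\<close> by simp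
    then have fixed_s: "{p \<in> {1..j - 1}. s p = p} = {f}"
      using s_fixed[OF _ inside] sf(1) by blast
    have "odd (low_count s (j - 1) (j - 1))"
      unfolding low_count_diag_parity[OF sD(2)] fixed_s by simp
    then have "odd (card {p \<in> {1..j - 1}. t p = p})"
      unfolding full low_count_diag_parity[OF tD(2)] .
    then have "{p \<in> {1..j - 1}. t p = p} \<noteq> {}" by (metis card.empty even_zero)
    then obtain p where "p \<in> {1..j - 1}" "t p = p" by blast
    then have "g < j" using t_fixed[OF _ inside, of p] j(1) by auto
    have "s g = g"
    proof (rule low_le_fixed_point[OF sD(2) tD(2) le _ tg(1)])
      fix k assume "0 < k" "k < g"
      then show "t k \<le> Suc k" using j_least \<open>g < j\<close> by simp
    qed (use tg in simp)
    then show False using s_fixed[of g] tg \<open>f < g\<close> by simp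
  qed
  have low: "low_count t k l \<le> j - 1" if "k \<le> i" "l \<le> i" for k l
  proof -
    have "{p \<in> {1..k}. t p \<le> l} \<subseteq> {1..j - 1}"
    proof
      fix p assume p: "p \<in> {p \<in> {1..k}. t p \<le> l}"
      then have "\<not> j \<le> p" using beyond[of p] that by auto
      with p show "p \<in> {1..j - 1}" by auto
    qed
    then have "low_count t k l \<le> card {1..j - 1}"
      unfolding low_count_def by (intro card_mono) auto
    then show ?thesis by simp
  qed
  have high: "j \<le> low_count s k l" if "f \<le> k" "f \<le> l" for k l
  proof -
    have "insert f {1..j - 1} \<subseteq> {p \<in> {1..k}. s p \<le> l}"
    proof
      fix p assume "p \<in> insert f {1..j - 1}"
      then show "p \<in> {p \<in> {1..k}. s p \<le> l}"
        using s_cut[of p] that \<open>j \<le> f\<close> sf by auto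
    qed
    then have "card (insert f {1..j - 1}) \<le> low_count s k l"
      unfolding low_count_def by (intro card_mono) auto
    moreover have "f \<notin> {1..j - 1}" using \<open>j \<le> f\<close> j by simp
    ultimately show ?thesis using j(1) by simp
  qed
  define r where "r = s(f := Suc i, i := i, Suc i := f)"
  have r: "low_count s k l = low_count r k l +
    (if f \<le> k \<and> f \<le> l \<and> k \<le> i \<and> l \<le> i \<and> (k < i \<or> l < i) then 1 else 0)" for k l
    unfolding r_def using sf si sSuc \<open>f < i\<close> by (intro low_count_move_fixed_point) auto
  have "r \<in> invol_class n 1"
    unfolding r_def move_fixed_point_eq_conjugate[OF sD(2) sf(1) si \<open>f < i\<close>]
    by (rule invol_class_conjugate[OF s]) (use sf i in \<open>auto intro: permutes_swap_id\<close>)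
  moreover have "low_le s r" unfolding low_le_def using r by simp
  moreover have "low_le r t"
    unfolding low_le_def
  proof (intro allI)
    fix k l
    have "low_count t k l \<le> low_count s k l" using le by (simp add: low_le_def)
    then show "low_count t k l \<le> low_count r k l"
      using r[of k l] low[of k l] high[of k l] j(1) by (auto split: if_splits)
  qed
  moreover have ri: "r i = i" by (simp add: r_def)
  then have "r \<noteq> s" using si by auto
  moreover have "r \<noteq> t"
  proof
    assume "r = t"
    then have "t i = i" using ri by simp
    then show False using long[OF \<open>j \<le> i\<close> order_refl] by simp
  qed
  ultimately show ?thesis by blast
qed

lemma stuck_reverse_conj:
  assumes s: "s \<in> invol_class n a" and t: "t \<in> invol_class n a" and stuck: "stuck n s t"
  shows "stuck n (reverse_conj n s) (reverse_conj n t)"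
  unfolding stuck_def
proof (intro allI impI)
  fix i assume desc: "proper_descent n (reverse_conj n t) i"
  then have i: "0 < i" "i < n" by (auto simp: proper_descent_def)
  let ?j = "n - i"
  note tD = invol_classD[OF t]
  have rev: "reversal n i = Suc ?j" "reversal n (Suc i) = ?j" "reversal n ?j = Suc i" "reversal n (Suc ?j) = i"
    using i by (auto simp: reversal_def)
  have t_rev: "reversal n (t p) = Suc n - t p" "t p \<in> {1..n}" if "p \<in> {1..n}" for p
    using tD(4)[of p] that by (auto simp: reversal_def)
  have "t (Suc ?j) < t ?j"
    using desc t_rev[of ?j] t_rev[of "Suc ?j"] i
    by (auto simp: proper_descent_def reverse_conj_def rev)
  moreover have "t ?j \<noteq> Suc ?j"
  proof
    assume "t ?j = Suc ?j"
    then have "reverse_conj n t (Suc i) = i" by (simp add: reverse_conj_def rev)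
    then have "reverse_conj n t i = Suc i"
      using invol_classD(2)[OF reverse_conj_in_class[OF t]] by (metis invol_simps(1))
    then show False using desc by (simp add: proper_descent_def)
  qed
  ultimately have "proper_descent n t ?j" using i by (simp add: proper_descent_def)
  then have sj: "s ?j = Suc ?j" and not_le: "\<not> low_le s (conj_adj ?j t)"
    using stuck by (auto simp: stuck_def)
  have "reverse_conj n s i = Suc i"
  proof -
    have "s (Suc ?j) = ?j" using sj invol_classD(2)[OF s] by (metis invol_simps(1))
    then show ?thesis by (simp add: reverse_conj_def rev)
  qed
  moreover have "\<not> low_le (reverse_conj n s) (conj_adj i (reverse_conj n t))"
  proof
    assume "low_le (reverse_conj n s) (conj_adj i (reverse_conj n t))"
    then have "low_le (reverse_conj n s) (reverse_conj n (conj_adj ?j t))"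
      using i by (simp add: reverse_conj_conj_adj)
    moreover have "conj_adj ?j t \<in> invol_class n a" using t i by (intro conj_adj_in_class) auto
    ultimately have "low_le (reverse_conj n (reverse_conj n s)) (reverse_conj n (reverse_conj n (conj_adj ?j t)))"
      using s by (metis low_le_reverse_conj invol_classD(1) reverse_conj_in_class)
    with not_le show False by simp
  qed
  ultimately show "reverse_conj n s i = Suc i \<and> \<not> low_le (reverse_conj n s) (conj_adj i (reverse_conj n t))" ..
qed

text \<open>
  The parity argument applies if \<open>s\<close> and \<open>t\<close> have the same fixed points, so they do not. Hence each has
  one fixed point, and the reversal brings these points into the order required above.
\<close>

lemma between_if_stuck:
  assumes s: "s \<in> invol_class n a" and t: "t \<in> invol_class n a" and "a \<le> 1"
    and le: "low_le s t" and "s \<noteq> t" and stuck: "stuck n s t"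
  shows "\<exists>r \<in> invol_class n a. r \<noteq> s \<and> r \<noteq> t \<and> low_le s r \<and> low_le r t"
proof -
  note sD = invol_classD[OF s] and tD = invol_classD[OF t]
  obtain i where desc: "proper_descent n t i"
    using minimal_if_no_proper_descent[OF s t le] \<open>s \<noteq> t\<close> by blast
  have i: "0 < i" "i < n" "t (Suc i) < t i" "t i \<noteq> Suc i"
    using desc by (auto simp: proper_descent_def)
  have si: "s i = Suc i" and not_le: "\<not> low_le s (conj_adj i t)"
    using stuck desc by (auto simp: stuck_def)
  have sSuc: "s (Suc i) = i" using si sD(2) by (metis invol_simps(1))
  have False if same: "{p \<in> {1..n}. s p = p} = {p \<in> {1..n}. t p = p}"
  proof -
    have "{p \<in> {1..i - 1}. s p = p} = {p \<in> {1..i - 1}. t p = p}"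
    proof (rule Collect_cong)
      fix p
      have "p \<in> {p \<in> {1..n}. s p = p} \<longleftrightarrow> p \<in> {p \<in> {1..n}. t p = p}" by (simp only: same)
      then show "p \<in> {1..i - 1} \<and> s p = p \<longleftrightarrow> p \<in> {1..i - 1} \<and> t p = p" using i by auto
    qed
    then have "even (low_count s (i - 1) (i - 1)) \<longleftrightarrow> even (low_count t (i - 1) (i - 1))"
      by (simp only: low_count_diag_parity[OF sD(2)] low_count_diag_parity[OF tD(2)])
    moreover have "t (Suc i) \<noteq> Suc i"
    proof
      assume "t (Suc i) = Suc i"
      then have "Suc i \<in> {p \<in> {1..n}. s p = p}" unfolding same using i by simp
      then show False using sSuc by simp
    qed
    ultimately have "low_le s (conj_adj i t)"
      using i si by (intro low_le_conj_adj_upper_if_swapped sD tD le) auto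
    with not_le show False ..
  qed
  note fixed_differ = this
  have "a \<noteq> 0"
  proof
    assume "a = 0"
    then have "{p \<in> {1..n}. s p = p} = {}" "{p \<in> {1..n}. t p = p} = {}"
      using sD(3) tD(3) by (simp_all only: card_eq_0_iff) simp_all
    then show False by (intro fixed_differ) (simp only:)
  qed
  with \<open>a \<le> 1\<close> have "a = 1" by simp
  obtain f where f: "{p \<in> {1..n}. s p = p} = {f}"
    using sD(3) \<open>a = 1\<close> by (metis (lifting) card_1_singletonE)
  obtain g where g: "{p \<in> {1..n}. t p = p} = {g}"
    using tD(3) \<open>a = 1\<close> by (metis (lifting) card_1_singletonE)
  have fp: "s f = f" "f \<in> {1..n}" and gp: "t g = g" "g \<in> {1..n}" using f g by blast+
  have "f \<noteq> g" using f g fixed_differ by (auto simp only:)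
  show ?thesis
  proof (cases "f < g")
    case True
    show ?thesis
      using between_if_stuck_left[of s n t f g] s t le \<open>s \<noteq> t\<close> stuck fp gp True \<open>a = 1\<close> by blast
  next
    case False
    let ?R = "reverse_conj n"
    have perms: "s permutes {1..n}" "t permutes {1..n}" using sD(1) tD(1) .
    have "?R s \<in> invol_class n 1" "?R t \<in> invol_class n 1"
      using s t \<open>a = 1\<close> by (auto intro: reverse_conj_in_class)
    moreover have "low_le (?R s) (?R t)" using perms le by (rule low_le_reverse_conj)
    moreover have "?R s \<noteq> ?R t" using \<open>s \<noteq> t\<close> by (metis reverse_conj_reverse_conj)
    moreover have "stuck n (?R s) (?R t)" using s t stuck by (rule stuck_reverse_conj)
    moreover have "?R s (reversal n f) = reversal n f" "?R t (reversal n g) = reversal n g"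
      using fp(1) gp(1) by (simp_all add: reverse_conj_def)
    moreover have "reversal n f \<in> {1..n}" "reversal n g \<in> {1..n}"
      using fp(2) gp(2) by (simp_all only: reversal_in_iff)
    moreover have "reversal n f < reversal n g"
      using fp(2) gp(2) False \<open>f \<noteq> g\<close> by (auto simp: reversal_def)
    ultimately obtain r where r: "r \<in> invol_class n 1" "r \<noteq> ?R s" "r \<noteq> ?R t"
        "low_le (?R s) r" "low_le r (?R t)"
      using between_if_stuck_left[of "?R s" n "?R t" "reversal n f" "reversal n g"] by blast
    have "low_le (?R (?R s)) (?R r)" "low_le (?R r) (?R (?R t))"
      using r \<open>?R s \<in> _\<close> \<open>?R t \<in> _\<close> by (metis low_le_reverse_conj invol_classD(1))+
    moreover have "?R r \<in> invol_class n a" using r(1) \<open>a = 1\<close> by (auto intro: reverse_conj_in_class)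
    moreover have "?R r \<noteq> s" "?R r \<noteq> t" using r(2,3) by (metis reverse_conj_reverse_conj)+
    ultimately show ?thesis by auto
  qed
qed

lemma at_most_one_fixed_point:
  assumes "s \<in> invol_class n a" "a \<le> 1" "p \<in> {1..n}" "q \<in> {1..n}" "s p = p" "s q = q"
  shows "p = q"
proof -
  have "card {i \<in> {1..n}. s i = i} \<le> Suc 0" using invol_classD(3)[OF assms(1)] assms(2) by simp
  then show ?thesis using assms(3-6) by (subst (asm) card_le_Suc0_iff_eq) auto
qed

text \<open>
  The last premise expresses that \<open>t\<close> covers \<open>s\<close>. A proper descent \<open>i\<close> of \<open>t\<close> at which the pair is not
  stuck leaves three cases, in each of which lifting produces elements that the cover does not allow
  to lie strictly between.
\<close>

lemma inv_number_cover:
  assumes "a \<le> 1"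
    and "s \<in> invol_class n a" "t \<in> invol_class n a" "low_le s t" "s \<noteq> t"
    and "\<And>r. r \<in> invol_class n a \<Longrightarrow> low_le s r \<Longrightarrow> low_le r t \<Longrightarrow> r = s \<or> r = t"
  shows "inv_number n t = inv_number n s + 2"
  using assms(2-)
proof (induction "inv_number n t" arbitrary: s t rule: less_induct)
  case less
  note s = less.prems(1) and t = less.prems(2) and le = less.prems(3) and neq = less.prems(4)
    and between = less.prems(5)
  note sD = invol_classD[OF s] and tD = invol_classD[OF t]
  have not_both_fixed: "r i \<noteq> i \<or> r (Suc i) \<noteq> Suc i" if "r \<in> invol_class n a" "0 < i" "i < n" for r i
    using at_most_one_fixed_point[OF that(1) assms(1), of i "Suc i"] that by auto
  have "\<not> stuck n s t"
    using between_if_stuck[OF s t assms(1) le neq] between by blast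
  then obtain i where desc: "proper_descent n t i" and i_cases: "s i \<noteq> Suc i \<or> low_le s (conj_adj i t)"
    by (auto simp: stuck_def)
  have i: "0 < i" "i < n" "t (Suc i) < t i" "t i \<noteq> Suc i"
    using desc by (auto simp: proper_descent_def)
  let ?s = "conj_adj i s" and ?t = "conj_adj i t"
  have s': "?s \<in> invol_class n a" and t': "?t \<in> invol_class n a"
    using s t i by (auto intro: conj_adj_in_class)
  note s'D = invol_classD[OF s'] and t'D = invol_classD[OF t']
  have t'_asc: "?t i < ?t (Suc i)" using i by (intro conj_adj_ascent_of_descent)
  have t'_le: "low_le ?t t"
    by (rule low_le_conj_adj_lower[OF tD(2) tD(2) i(1) low_le_refl i(3)])
  have t'_inv: "inv_number n t = inv_number n ?t + 2"
    using inv_number_conj_adj[OF t'D(2,1) i(1,2) t'_asc not_both_fixed[OF t' i(1,2)]] by simp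
  have "s i \<noteq> s (Suc i)" using invol_eq_iff[OF sD(2)] by simp
  then consider "s i < s (Suc i)" | "low_le s ?t" | "s (Suc i) < s i" "s i \<noteq> Suc i"
    using i_cases by linarith
  then show ?case
  proof cases
    case 1
    have "low_le s ?s"
      by (rule low_le_conj_adj_upper[OF sD(2) sD(2) i(1) low_le_refl 1])
    moreover have "low_le ?s t"
      by (rule low_le_conj_adj_lower[OF sD(2) tD(2) i(1) le i(3)])
    moreover have "?s \<noteq> s"
      using conj_adj_descent_of_ascent[OF 1 not_both_fixed[OF s i(1,2)]] 1 by auto
    ultimately have "?s = t" using between[OF s'] by blast
    then show ?thesis
      using inv_number_conj_adj[OF sD(2,1) i(1,2) 1 not_both_fixed[OF s i(1,2)]] by simp
  next
    case 2
    have "?t \<noteq> t" using t'_asc i(3) by auto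
    then have "?t = s" using between[OF t' 2 t'_le] by blast
    then show ?thesis using t'_inv by simp
  next
    case 3
    have s'_asc: "?s i < ?s (Suc i)" using 3 by (intro conj_adj_ascent_of_descent)
    have s'_inv: "inv_number n s = inv_number n ?s + 2"
      using inv_number_conj_adj[OF s'D(2,1) i(1,2) s'_asc not_both_fixed[OF s' i(1,2)]] by simp
    have s'_le: "low_le ?s s"
      by (rule low_le_conj_adj_lower[OF sD(2) sD(2) i(1) low_le_refl 3(1)])
    have le': "low_le ?s ?t"
      by (rule low_le_conj_adj_upper[OF s'D(2) tD(2) i(1) low_le_trans[OF s'_le le] s'_asc])
    \<comment> \<open>The conjugates again form a cover: an element between them, or its conjugate if it has an ascent
      at \<open>i\<close>, lies between \<open>s\<close> and \<open>t\<close>.\<close>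
    have "inv_number n ?t = inv_number n ?s + 2"
    proof (rule less.hyps)
      show "inv_number n ?t < inv_number n t" using t'_inv by simp
      show "?s \<noteq> ?t" using neq by (metis conj_adj_conj_adj)
      fix r assume r: "r \<in> invol_class n a" and r_le: "low_le ?s r" "low_le r ?t"
      note rD = invol_classD[OF r]
      have "r i \<noteq> r (Suc i)" using invol_eq_iff[OF rD(2)] by simp
      then consider "r i < r (Suc i)" | "r (Suc i) < r i" by linarith
      then show "r = ?s \<or> r = ?t"
      proof cases
        case 1
        let ?r = "conj_adj i r"
        have r': "?r \<in> invol_class n a" using r i by (intro conj_adj_in_class)
        have "low_le r ?r"
          by (rule low_le_conj_adj_upper[OF rD(2) rD(2) i(1) low_le_refl 1])
        then have "low_le ?s ?r" using r_le(1) low_le_trans by blast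
        then have "low_le (conj_adj i ?s) ?r"
          by (rule low_le_conj_adj_lower[OF s'D(2) invol_classD(2)[OF r'] i(1) _
                conj_adj_descent_of_ascent[OF 1 not_both_fixed[OF r i(1,2)]]])
        moreover have "low_le ?r t"
          by (rule low_le_conj_adj_lower[OF rD(2) tD(2) i(1) low_le_trans[OF r_le(2) t'_le] i(3)])
        ultimately have "?r = s \<or> ?r = t" using between[OF r'] by simp
        then show ?thesis by (metis conj_adj_conj_adj)
      next
        case 2
        have "low_le (conj_adj i ?s) r"
          by (rule low_le_conj_adj_lower[OF s'D(2) rD(2) i(1) r_le(1) 2])
        then have "low_le s r" by simp
        then have "low_le s ?t" using r_le(2) low_le_trans by blast
        then have "?t = s \<or> ?t = t" using between[OF t' _ t'_le] by blast
        then show ?thesis using t'_asc 3(1) i(3) by auto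
      qed
    qed (fact s' t' le')+
    then show ?thesis using t'_inv s'_inv by simp
  qed
qed

section \<open>Finite graded posets\<close>

text \<open>
  The carrier is an explicit set and \<open>le\<close> is only assumed to be an order on it, as the Bruhat order does
  not separate functions that differ outside of \<open>{1..n}\<close>.
\<close>

locale finite_poset =
  fixes A :: "'a set" and le :: "'a \<Rightarrow> 'a \<Rightarrow> bool"
  assumes fin: "finite A"
    and refl: "x \<in> A \<Longrightarrow> le x x"
    and antisym: "x \<in> A \<Longrightarrow> y \<in> A \<Longrightarrow> le x y \<Longrightarrow> le y x \<Longrightarrow> x = y"
    and trans: "x \<in> A \<Longrightarrow> y \<in> A \<Longrightarrow> z \<in> A \<Longrightarrow> le x y \<Longrightarrow> le y z \<Longrightarrow> le x z"
begin

lemma finite_subset_has_maximal: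
  assumes "B \<subseteq> A" "B \<noteq> {}"
  shows "\<exists>m\<in>B. \<forall>b\<in>B. le m b \<longrightarrow> b = m"
proof -
  have "finite B" using fin assms(1) by (rule finite_subset[rotated])
  from this assms(2,1) show ?thesis
  proof (induction B rule: finite_ne_induct)
    case (insert x B)
    then obtain m where m: "m \<in> B" "\<forall>b\<in>B. le m b \<longrightarrow> b = m" by auto
    show ?case
    proof (cases "le m x")
      case True
      have "b = x" if "b \<in> insert x B" "le x b" for b
        using that True m insert.prems antisym trans by (metis insertE insert_subset subsetD)
      then show ?thesis by blast
    next
      case False
      then show ?thesis using m by auto
    qed
  qed simp
qed

lemma covered_by_interval:
  assumes "x \<in> A" "y \<in> A" "le x y" "x \<noteq> y"
  shows "\<exists>z\<in>A. le x z \<and> covers_in A le y z"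
proof -
  let ?B = "{z \<in> A. le x z \<and> le z y \<and> z \<noteq> y}"
  have "x \<in> ?B" using assms refl by simp
  then obtain m where m: "m \<in> ?B" "\<forall>b\<in>?B. le m b \<longrightarrow> b = m"
    using finite_subset_has_maximal[of ?B] by blast
  have "covers_in A le y m"
    unfolding covers_in_def
  proof (intro conjI ballI impI)
    fix z assume z: "z \<in> A" "le m z \<and> le z y"
    then have "le x z" using m(1) assms(1) trans[of x m z] by simp
    then show "z = m \<or> z = y" using m z by blast
  qed (use m assms in auto)
  then show ?thesis using m(1) by blast
qed

lemma card_below_less:
  assumes "x \<in> A" "y \<in> A" "le x y" "x \<noteq> y"
  shows "card {w \<in> A. le w x} < card {w \<in> A. le w y}"
proof (rule psubset_card_mono)
  have "{w \<in> A. le w x} \<subseteq> {w \<in> A. le w y}" using trans assms by blast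
  moreover have "y \<in> {w \<in> A. le w y}" "y \<notin> {w \<in> A. le w x}"
    using refl antisym assms by auto
  ultimately show "{w \<in> A. le w x} \<subset> {w \<in> A. le w y}" by blast
qed (simp add: fin)

lemma covers_induct [consumes 1, case_names minimal cover]:
  assumes "x \<in> A"
    and "\<And>x. minimal_in A le x \<Longrightarrow> P x"
    and "\<And>x y. covers_in A le y x \<Longrightarrow> P x \<Longrightarrow> P y"
  shows "P x"
  using assms(1)
proof (induction "card {z \<in> A. le z x}" arbitrary: x rule: less_induct)
  case less
  show ?case
  proof (cases "minimal_in A le x")
    case False
    then obtain w where "w \<in> A" "le w x" "w \<noteq> x" using less.prems by (auto simp: minimal_in_def)
    then obtain z where z: "z \<in> A" "covers_in A le x z"
      using covered_by_interval less.prems by blast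
    then have zx: "le z x" "z \<noteq> x" by (auto simp: covers_in_def)
    have "card {w \<in> A. le w z} < card {w \<in> A. le w x}"
      using z(1) less.prems zx by (intro card_below_less)
    then have "P z" using less.hyps z by blast
    then show ?thesis using assms(3) z by blast
  qed (rule assms(2))
qed

text \<open>
  Every element is reached from a minimal one by covers, so \<open>h\<close> takes values in \<open>c + 2\<nat>\<close>, and any rank
  function is determined by it.
\<close>

lemma rank_function_from_statistic:
  assumes minimal: "\<And>x. minimal_in A le x \<Longrightarrow> h x = c"
    and cover: "\<And>x y. covers_in A le y x \<Longrightarrow> h y = h x + 2"
  shows "is_rank_function A le (\<lambda>x. (h x - c) div 2)"
    and "is_rank_function A le \<rho> \<Longrightarrow> x \<in> A \<Longrightarrow> h x = c + 2 * \<rho> x"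
proof -
  have ge: "c \<le> h x" if "x \<in> A" for x
    using that by (induction rule: covers_induct) (simp_all add: minimal cover)
  show "is_rank_function A le (\<lambda>x. (h x - c) div 2)"
    unfolding is_rank_function_def
  proof (intro conjI allI impI)
    fix x y assume xy: "covers_in A le y x"
    then have "c \<le> h x" by (intro ge) (simp add: covers_in_def)
    then show "(h y - c) div 2 = (h x - c) div 2 + 1" by (simp add: cover[OF xy])
  qed (simp add: minimal)
  assume \<rho>: "is_rank_function A le \<rho>" and "x \<in> A"
  from \<open>x \<in> A\<close> show "h x = c + 2 * \<rho> x"
    by (induction rule: covers_induct)
       (use \<rho> in \<open>simp_all add: minimal cover is_rank_function_def\<close>)
qed

lemma rank_function_strict_mono:
  assumes "is_rank_function A le \<rho>" "x \<in> A" "y \<in> A" "le x y" "x \<noteq> y"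
  shows "\<rho> x < \<rho> y"
proof -
  show ?thesis
    using assms(3-5)
  proof (induction "card {w \<in> A. le w y}" arbitrary: y rule: less_induct)
    case less
    obtain z where z: "z \<in> A" "le x z" "covers_in A le y z"
      using covered_by_interval[OF assms(2) less.prems] by blast
    then have zy: "le z y" "z \<noteq> y" "\<rho> y = \<rho> z + 1"
      using assms(1) by (auto simp: covers_in_def is_rank_function_def)
    then have "card {w \<in> A. le w z} < card {w \<in> A. le w y}"
      using z less.prems by (intro card_below_less)
    then have "\<rho> x < \<rho> z" if "x \<noteq> z"
      using less.hyps[OF _ z(1,2) that] by simp
    then show ?case using zy by (cases "x = z") auto
  qed
qed

text \<open>
  A maximal chain contains the greatest element \<open>w\<close>. Below any of its elements \<open>x\<close> the chain continues
  with an element that \<open>x\<close> covers, unless \<open>x\<close> is minimal in the poset. So the rank function maps the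
  chain bijectively onto \<open>{0..\<rho> w}\<close>.
\<close>

lemma graded_poset_if_rank_function:
  assumes \<rho>: "is_rank_function A le \<rho>" and top: "w \<in> A" "\<And>x. x \<in> A \<Longrightarrow> le x w"
  shows "graded_poset_of_rank A le (\<rho> w)"
  unfolding graded_poset_of_rank_def
proof (intro allI impI)
  fix C assume max: "pred_on.maxchain A le C"
  have chain: "C \<subseteq> A" "\<And>x y. x \<in> C \<Longrightarrow> y \<in> C \<Longrightarrow> le x y \<or> le y x"
    using max refl unfolding pred_on.maxchain_def pred_on.chain_def by auto
  have extend: "x \<in> C" if "x \<in> A" "\<And>y. y \<in> C \<Longrightarrow> le x y \<or> le y x" for x
  proof (rule ccontr)
    assume "x \<notin> C"
    have "pred_on.chain A le (insert x C)"
      using chain that refl unfolding pred_on.chain_def by auto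
    moreover have "C \<subset> insert x C" using \<open>x \<notin> C\<close> by blast
    ultimately show False using max unfolding pred_on.maxchain_def by blast
  qed
  have "w \<in> C" using top chain(1) by (intro extend) auto
  have inj: "inj_on \<rho> C"
  proof (rule inj_onI, rule ccontr)
    fix x y assume xy: "x \<in> C" "y \<in> C" "\<rho> x = \<rho> y" "x \<noteq> y"
    then have "x \<in> A" "y \<in> A" "le x y \<or> le y x" using chain by auto
    then show False
      using xy rank_function_strict_mono[OF \<rho>, of x y] rank_function_strict_mono[OF \<rho>, of y x] by auto
  qed
  have down: "r \<in> \<rho> ` C" if r: "Suc r \<in> \<rho> ` C" for r
  proof -
    obtain x where x: "x \<in> C" "\<rho> x = Suc r" using r by force
    let ?B = "{z \<in> C. le z x \<and> z \<noteq> x}"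
    have xA: "x \<in> A" using x chain by blast
    have "?B \<noteq> {}"
    proof
      assume empty: "?B = {}"
      have "minimal_in A le x"
        unfolding minimal_in_def
      proof (intro conjI ballI impI xA)
        fix z assume z: "z \<in> A" "le z x"
        have "le z y" if "y \<in> C" for y
        proof -
          have "le x y" using that empty chain(2)[OF that x(1)] refl[OF xA] by blast
          then show ?thesis using trans[of z x y] z xA chain(1) that by blast
        qed
        then have "z \<in> C" using z by (intro extend) auto
        then show "z = x" using empty z by blast
      qed
      then show False using \<rho> x by (simp add: is_rank_function_def)
    qed
    then obtain m where m: "m \<in> ?B" "\<forall>b\<in>?B. le m b \<longrightarrow> b = m"
      using finite_subset_has_maximal[of ?B] chain(1) by blast
    then have mA: "m \<in> A" using chain by blast
    have "covers_in A le x m"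
      unfolding covers_in_def
    proof (intro conjI ballI impI)
      fix z assume z: "z \<in> A" "le m z \<and> le z x"
      have "le z y \<or> le y z" if y: "y \<in> C" for y
      proof -
        have yA: "y \<in> A" using y chain by blast
        consider "le x y" | "le y x" "y \<noteq> x" using chain(2)[OF y x(1)] refl[OF xA] by blast
        then show ?thesis
        proof cases
          case 1
          then show ?thesis using trans[of z x y] z xA yA by blast
        next
          case 2
          then have "y \<in> ?B" using y by simp
          then have "le y m" using m chain(2)[OF y, of m] refl[OF mA] by blast
          then show ?thesis using trans[of y m z] z mA yA by blast
        qed
      qed
      then have "z \<in> C" using z by (intro extend) auto
      then show "z = m \<or> z = x" using m(2) z by blast
    qed (use m mA xA in auto)
    then have "\<rho> x = \<rho> m + 1" using \<rho> by (simp add: is_rank_function_def)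
    then show ?thesis using x m by auto
  qed
  have "\<rho> ` C = {..\<rho> w}"
  proof
    show "\<rho> ` C \<subseteq> {..\<rho> w}"
    proof
      fix r assume "r \<in> \<rho> ` C"
      then obtain x where x: "x \<in> C" "r = \<rho> x" by blast
      then have "x \<in> A" using chain by blast
      then show "r \<in> {..\<rho> w}"
        using rank_function_strict_mono[OF \<rho> _ top(1) top(2), of x] x by (cases "x = w") auto
    qed
    show "{..\<rho> w} \<subseteq> \<rho> ` C"
    proof
      fix r assume "r \<in> {..\<rho> w}"
      then have "r \<le> \<rho> w" by simp
      then show "r \<in> \<rho> ` C"
        using \<open>w \<in> C\<close> down by (induction rule: inc_induct) auto
    qed
  qed
  then have "card {..\<rho> w} = card C" using card_image[OF inj] by simp
  then show "card C = \<rho> w + 1" by simp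
qed

text \<open>
  In a finite poset, a largest chain among those that contain \<open>C\<close>.
\<close>

lemma chain_extends_to_maxchain:
  assumes "pred_on.chain A le C"
  shows "\<exists>M. pred_on.maxchain A le M \<and> C \<subseteq> M"
proof -
  let ?S = "{D. pred_on.chain A le D \<and> C \<subseteq> D}"
  have "finite ?S"
    by (rule finite_subset[of _ "Pow A"]) (auto simp: pred_on.chain_def fin)
  moreover have "C \<in> ?S" using assms by simp
  ultimately obtain M where M: "M \<in> ?S" "\<forall>D\<in>?S. M \<subseteq> D \<longrightarrow> M = D"
    using finite_has_maximal[of ?S] by blast
  have "pred_on.maxchain A le M"
    unfolding pred_on.maxchain_def
  proof (intro conjI notI)
    assume "\<exists>D. pred_on.chain A le D \<and> M \<subset> D"
    then obtain D where "pred_on.chain A le D" "M \<subset> D" by blast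
    then show False using M by blast
  qed (use M in blast)
  then show ?thesis using M by blast
qed

text \<open>
  A maximal chain through \<open>x < y < z\<close> has no further element between \<open>x\<close> and \<open>z\<close>. Replacing \<open>y\<close> in it by
  \<open>u < v\<close> gives a chain with one more element.
\<close>

lemma not_graded_if_two_chains:
  assumes xy: "covers_in A le y x" and yz: "covers_in A le z y"
    and uv: "u \<in> A" "v \<in> A" "le x u" "le u v" "le v z" "x \<noteq> u" "u \<noteq> v" "v \<noteq> z"
  shows "\<not> graded_poset A le"
proof
  assume "graded_poset A le"
  then obtain r where r: "\<And>C. pred_on.maxchain A le C \<Longrightarrow> card C = r + 1"
    by (auto simp: graded_poset_def graded_poset_of_rank_def)
  have A: "x \<in> A" "y \<in> A" "z \<in> A" and le: "le x y" "le y z" "x \<noteq> y" "y \<noteq> z"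
    using xy yz by (auto simp: covers_in_def)
  have between_xy: "w = x \<or> w = y" if "w \<in> A" "le x w" "le w y" for w
    using that xy by (auto simp: covers_in_def)
  have between_yz: "w = y \<or> w = z" if "w \<in> A" "le y w" "le w z" for w
    using that yz by (auto simp: covers_in_def)
  have "le x z" using trans[of x y z] A le by blast
  have "le x v" "le u z" using trans[of x u v] trans[of u v z] A uv by auto
  have "pred_on.chain A le {x, y, z}"
    unfolding pred_on.chain_def using A le \<open>le x z\<close> by auto
  then obtain M where M: "pred_on.maxchain A le M" "{x, y, z} \<subseteq> M"
    using chain_extends_to_maxchain by blast
  have chain: "M \<subseteq> A" "\<And>p q. p \<in> M \<Longrightarrow> q \<in> M \<Longrightarrow> le p q \<or> le q p"
    using M(1) refl unfolding pred_on.maxchain_def pred_on.chain_def by auto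
  have finM: "finite M" using fin chain(1) by (rule finite_subset[rotated])
  have outside: "le p x \<or> le z p" if p: "p \<in> M" "p \<noteq> y" for p
  proof (rule ccontr)
    assume not: "\<not> ?thesis"
    have pA: "p \<in> A" using p chain by blast
    have "le x p" "le p z" using not chain(2)[of p x] chain(2)[of p z] p M(2) by auto
    moreover have "le p y \<or> le y p" using chain(2)[of p y] p M(2) by auto
    ultimately have "p = x \<or> p = y \<or> p = z" using between_xy between_yz pA by blast
    then show False using p(2) not refl A by blast
  qed
  let ?N = "insert u (insert v (M - {y}))"
  have comparable: "le p q \<or> le q p" if "p \<in> M - {y}" "q \<in> {u, v}" for p q
  proof -
    have pA: "p \<in> A" using that chain by blast
    have q: "q \<in> A" "le x q" "le q z" using that uv \<open>le x v\<close> \<open>le u z\<close> by auto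
    have "le p x \<or> le z p" using outside that by blast
    then show ?thesis using trans[of p x q] trans[of q z p] pA A q by blast
  qed
  have "pred_on.chain A le ?N"
    unfolding pred_on.chain_def
  proof (intro conjI ballI)
    show "?N \<subseteq> A" using chain(1) uv by blast
    fix p q assume pq: "p \<in> ?N" "q \<in> ?N"
    have "le p q \<or> le q p"
    proof (cases "p \<in> M \<and> q \<in> M")
      case False
      then consider "p \<in> M - {y}" "q \<in> {u, v}" | "q \<in> M - {y}" "p \<in> {u, v}"
        | "p \<in> {u, v}" "q \<in> {u, v}" using pq by blast
      then show ?thesis
      proof cases
        case 3
        then show ?thesis using uv refl by auto
      qed (use comparable in blast)+
    qed (use chain(2) in blast)
    then show "le\<^sup>=\<^sup>= p q \<or> le\<^sup>=\<^sup>= q p" by auto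
  qed
  then obtain N where N: "pred_on.maxchain A le N" "?N \<subseteq> N"
    using chain_extends_to_maxchain by blast
  have finN: "finite N"
    using N(1) fin unfolding pred_on.maxchain_def pred_on.chain_def by (auto intro: finite_subset)
  have not_in: "q \<notin> M - {y}" if q: "q \<in> {u, v}" for q
  proof
    assume "q \<in> M - {y}"
    then have "le q x \<or> le z q" using outside by blast
    moreover have "q \<in> A" "le x q" "le q z" "q \<noteq> x" "q \<noteq> z"
      using q uv \<open>le x v\<close> \<open>le u z\<close> A antisym[of u v] antisym[of x v] antisym[of u z] by auto
    ultimately show False using antisym A by blast
  qed
  have "card ?N = card M + 1"
    using not_in[of u] not_in[of v] uv(7) finM M(2) card_Suc_Diff1[of M y]
    by (simp add: card_insert_if)
  moreover have "card ?N \<le> card N" using finN N(2) by (rule card_mono)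
  ultimately show False using r[OF M(1)] r[OF N(1)] by simp
qed

end

section \<open>Rank functions and gradedness of the classes\<close>

lemma bruhat_le_in_class:
  "s \<in> invol_class n a \<Longrightarrow> t \<in> invol_class n a \<Longrightarrow> bruhat_le n s t \<longleftrightarrow> low_le s t"
  by (intro bruhat_le_iff_low_le invol_classD(1))

lemma finite_poset_invol_class: "finite_poset (invol_class n a) (bruhat_le n)"
proof
  show "finite (invol_class n a)" by (rule finite_invol_class)
  show "bruhat_le n x x" for x by (simp add: bruhat_le_def)
  show "bruhat_le n x y \<Longrightarrow> bruhat_le n y z \<Longrightarrow> bruhat_le n x z" for x y z
    unfolding bruhat_le_def by (meson order_trans)
  fix x y assume xy: "x \<in> invol_class n a" "y \<in> invol_class n a" "bruhat_le n x y" "bruhat_le n y x"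
  moreover have "x 0 = y 0" using xy(1,2) by (metis invol_classD(2) invol_simps(2))
  ultimately show "x = y" by (simp add: bruhat_le_in_class low_le_antisym)
qed

lemma inv_number_minimal:
  assumes "minimal_in (invol_class n a) (bruhat_le n) s"
  shows "inv_number n s = (n - a) div 2"
proof -
  have s: "s \<in> invol_class n a" using assms by (simp add: minimal_in_def)
  have "\<not> proper_descent n s i" for i
  proof
    assume "proper_descent n s i"
    then have i: "0 < i" "i < n" "s (Suc i) < s i" "s i \<noteq> Suc i" by (auto simp: proper_descent_def)
    note sD = invol_classD[OF s]
    have s': "conj_adj i s \<in> invol_class n a" using s i by (intro conj_adj_in_class)
    moreover have "low_le (conj_adj i s) s"
      using sD(2) i by (intro low_le_conj_adj_lower low_le_refl)
    ultimately have "conj_adj i s = s"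
      using assms s by (simp add: minimal_in_def bruhat_le_in_class)
    then show False using conj_adj_ascent_of_descent[of s i] i by simp
  qed
  then show ?thesis using inv_number_if_no_proper_descent[OF s] by simp
qed

text \<open>
  The common reason for the four positive results: it makes \<open>(inv_number n s - (n - a) / 2) / 2\<close> the
  rank function of the class.
\<close>

definition covers_add_two_inversions :: "nat \<Rightarrow> nat \<Rightarrow> bool" where
  "covers_add_two_inversions n a \<longleftrightarrow>
     (\<forall>s t. covers_in (invol_class n a) (bruhat_le n) t s \<longrightarrow> inv_number n t = inv_number n s + 2)"

lemma rank_function_invol_class:
  assumes "covers_add_two_inversions n a"
  shows "rank_function_given_by (invol_class n a) (bruhat_le n)
           (\<lambda>s. (real (inv_number n s) - real ((n - a) div 2)) / 2)"
proof -
  interpret finite_poset "invol_class n a" "bruhat_le n" by (rule finite_poset_invol_class)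
  note rank = rank_function_from_statistic[where h = "inv_number n" and c = "(n - a) div 2"]
  have cover: "covers_in (invol_class n a) (bruhat_le n) t s \<Longrightarrow> inv_number n t = inv_number n s + 2" for s t
    using assms by (simp add: covers_add_two_inversions_def)
  show ?thesis
    unfolding rank_function_given_by_def
  proof (intro conjI allI impI ballI)
    show "\<exists>\<rho>. is_rank_function (invol_class n a) (bruhat_le n) \<rho>"
      using rank(1) inv_number_minimal cover by blast
    fix \<rho> s assume "is_rank_function (invol_class n a) (bruhat_le n) \<rho>" "s \<in> invol_class n a"
    then have "inv_number n s = (n - a) div 2 + 2 * \<rho> s"
      using inv_number_minimal cover by (intro rank(2))
    then show "real (\<rho> s) = (real (inv_number n s) - real ((n - a) div 2)) / 2" by simp
  qed
qed

lemma graded_invol_class: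
  assumes "covers_add_two_inversions n a" "w \<in> invol_class n a"
    "\<And>s. s \<in> invol_class n a \<Longrightarrow> low_le s w"
  shows "graded_poset (invol_class n a) (bruhat_le n)"
proof -
  interpret finite_poset "invol_class n a" "bruhat_le n" by (rule finite_poset_invol_class)
  obtain \<rho> where "is_rank_function (invol_class n a) (bruhat_le n) \<rho>"
    using rank_function_invol_class[OF assms(1)] by (auto simp: rank_function_given_by_def)
  then show ?thesis
    using graded_poset_if_rank_function[of \<rho> w] assms(2,3)
    by (auto simp: graded_poset_def bruhat_le_in_class)
qed

lemma covers_add_two_inversions_few_fixed_points:
  assumes "a \<le> 1"
  shows "covers_add_two_inversions n a"
  unfolding covers_add_two_inversions_def
proof (intro allI impI)
  fix s t assume "covers_in (invol_class n a) (bruhat_le n) t s"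
  then have st: "s \<in> invol_class n a" "t \<in> invol_class n a" "low_le s t" "s \<noteq> t"
    and between: "\<And>r. r \<in> invol_class n a \<Longrightarrow> low_le s r \<Longrightarrow> low_le r t \<Longrightarrow> r = s \<or> r = t"
    unfolding covers_in_def by (auto simp: bruhat_le_in_class)
  show "inv_number n t = inv_number n s + 2"
    using assms st between by (rule inv_number_cover)
qed

lemma reversal_in_class: "reversal n \<in> invol_class n (n mod 2)"
proof -
  have "{i \<in> {1..n}. reversal n i = i} = (if even n then {} else {Suc n div 2})"
    by (auto simp: reversal_def elim!: evenE oddE) presburger+
  then have "card {i \<in> {1..n}. reversal n i = i} = n mod 2"
    by (simp add: odd_iff_mod_2_eq_one even_iff_mod_2_eq_zero)
  then show ?thesis
    by (simp add: invol_class_def reversal_permutes fun_eq_iff del: One_nat_def)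
qed

text \<open>
  By inclusion and exclusion \<open>M\<^sub>s(k, l) \<ge> k + l - n\<close> for every permutation \<open>s\<close>, and the reversal attains
  this bound.
\<close>

lemma low_le_reversal:
  assumes "s permutes {1..n}"
  shows "low_le s (reversal n)"
  unfolding low_le_def
proof (intro allI)
  fix k l
  show "low_count (reversal n) k l \<le> low_count s k l"
  proof (cases "k \<le> n \<and> l \<le> n")
    case True
    have "{i \<in> {1..k}. reversal n i \<le> l} \<subseteq> {Suc n - l..k}"
      using True by (auto simp: reversal_def)
    then have "low_count (reversal n) k l \<le> card {Suc n - l..k}"
      unfolding low_count_def by (intro card_mono) auto
    moreover have "reverse_conj n s permutes {1..n}"
      unfolding reverse_conj_def by (intro permutes_compose reversal_permutes assms)
    then have "k + l \<le> low_count s k l + n"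
      using low_count_reverse_conj[of "reverse_conj n s" n k l] True by simp
    ultimately show ?thesis using True by simp
  next
    case False
    then show ?thesis
      using low_count_permutes_outside[OF assms, of k l]
            low_count_permutes_outside[OF reversal_permutes, of n k l] by auto
  qed
qed

lemma graded_few_fixed_points:
  assumes "a \<le> 1" "invol_class n a \<noteq> {}"
  shows "graded_poset (invol_class n a) (bruhat_le n)"
proof -
  obtain s where "s \<in> invol_class n a" using assms(2) by blast
  then have "n mod 2 = a" using invol_class_size[of s n a] assms(1) by presburger
  then show ?thesis
    using covers_add_two_inversions_few_fixed_points[OF assms(1)] reversal_in_class[of n]
    by (intro graded_invol_class[where w = "reversal n"] low_le_reversal invol_classD(1)) auto
qed

section \<open>Transpositions and the identity\<close>

text \<open>
  Counting points, \<open>n - 2\<close> fixed points leave room for exactly one two-cycle.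
\<close>

lemma transposition_class:
  assumes "n \<ge> 2" "s \<in> invol_class n (n - 2)"
  shows "\<exists>i j. 0 < i \<and> i < j \<and> j \<le> n \<and> s = transpose i j"
proof -
  note sD = invol_classD[OF assms(2)]
  have "card {p \<in> {1..n}. p < s p} = 1" using invol_class_size[OF assms(2)] assms(1) by linarith
  then obtain i where i: "{p \<in> {1..n}. p < s p} = {i}" by (rule card_1_singletonE)
  then have i': "i \<in> {1..n}" "i < s i" by blast+
  have opener: "p = i" if "p < s p" for p
  proof -
    have "p \<in> {1..n}" using sD(5)[of p] that by (metis less_irrefl)
    then have "p \<in> {p \<in> {1..n}. p < s p}" using that by simp
    then show ?thesis unfolding i by simp
  qed
  have "s p = transpose i (s i) p" for p
  proof -
    consider "s p = p" | "p < s p" | "s p < p" by linarith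
    then show ?thesis
    proof cases
      case 1
      then have "p \<noteq> i" "p \<noteq> s i" using i'(2) sD(2) by (metis invol_simps(1) less_irrefl)+
      with 1 show ?thesis by simp
    next
      case 2
      then show ?thesis using opener by simp
    next
      case 3
      then have "s p = i" using opener[of "s p"] sD(2) by simp
      then have "p = s i" using sD(2) by (metis invol_simps(1))
      then show ?thesis using \<open>s p = i\<close> by simp
    qed
  qed
  then have eq: "s = transpose i (s i)" by (rule ext)
  have bounds: "0 < i" "s i \<le> n" using sD(4)[of i] i'(1) by simp_all
  show ?thesis
    by (rule exI[of _ i], rule exI[of _ "s i"], intro conjI) (fact bounds i'(2) eq)+
qed

lemma low_count_transpose:
  assumes "0 < i" "i < j"
  shows "low_count (transpose i j) k l + (if i \<le> k \<and> k < j \<and> i \<le> l \<and> l < j then 1 else 0) = min k l"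
proof (induction k)
  case (Suc k)
  consider "Suc k = i" | "Suc k = j" | "Suc k \<noteq> i" "Suc k \<noteq> j" by blast
  then show ?case
  proof cases
    case 1
    then have "transpose i j (Suc k) = j" by simp
    then show ?thesis
      using Suc 1[symmetric] assms by (auto simp: low_count_Suc min_def split: if_splits)
  next
    case 2
    then have "transpose i j (Suc k) = i" by simp
    then show ?thesis
      using Suc 2[symmetric] assms by (auto simp: low_count_Suc min_def split: if_splits)
  next
    case 3
    then have "transpose i j (Suc k) = Suc k" "i \<le> Suc k \<longleftrightarrow> i \<le> k" "Suc k < j \<longleftrightarrow> k < j" by auto
    then show ?thesis using Suc by (simp add: low_count_Suc min_def split: if_splits)
  qed
qed (use assms in simp)

text \<open>
  The table of \<open>(i, j)\<close> is that of the identity lowered by one on the square \<open>[i, j)\<^sup>2\<close>, so the order is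
  inclusion of squares.
\<close>

lemma low_le_transpose_iff:
  assumes "0 < i" "i < j" "0 < k" "k < l"
  shows "low_le (transpose i j) (transpose k l) \<longleftrightarrow> k \<le> i \<and> j \<le> l"
proof
  assume le: "low_le (transpose i j) (transpose k l)"
  have "low_count (transpose k l) i i \<le> low_count (transpose i j) i i"
    "low_count (transpose k l) (j - 1) (j - 1) \<le> low_count (transpose i j) (j - 1) (j - 1)"
    using le by (simp_all add: low_le_def)
  then show "k \<le> i \<and> j \<le> l"
    using low_count_transpose[OF assms(1,2), of i i] low_count_transpose[OF assms(3,4), of i i]
      low_count_transpose[OF assms(1,2), of "j - 1" "j - 1"]
      low_count_transpose[OF assms(3,4), of "j - 1" "j - 1"] assms
    by (simp split: if_splits)
next
  assume kl: "k \<le> i \<and> j \<le> l"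
  show "low_le (transpose i j) (transpose k l)"
    unfolding low_le_def
  proof (intro allI)
    fix p q
    show "low_count (transpose k l) p q \<le> low_count (transpose i j) p q"
      using low_count_transpose[OF assms(1,2), of p q] low_count_transpose[OF assms(3,4), of p q] kl
      by (auto simp: min_def split: if_splits)
  qed
qed

text \<open>
  A smaller interval can be enlarged by one point at its left or right end without leaving the
  larger interval, and this enlargement is a conjugation at an ascent.
\<close>

lemma covers_add_two_inversions_transpositions:
  assumes "n \<ge> 2"
  shows "covers_add_two_inversions n (n - 2)"
  unfolding covers_add_two_inversions_def
proof (intro allI impI)
  fix s t assume "covers_in (invol_class n (n - 2)) (bruhat_le n) t s"
  then have s: "s \<in> invol_class n (n - 2)" and t: "t \<in> invol_class n (n - 2)" and "low_le s t" "s \<noteq> t"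
    and between: "\<And>r. r \<in> invol_class n (n - 2) \<Longrightarrow> low_le s r \<Longrightarrow> low_le r t \<Longrightarrow> r = s \<or> r = t"
    unfolding covers_in_def by (auto simp: bruhat_le_in_class)
  note sD = invol_classD[OF s]
  obtain i j where ij: "0 < i" "i < j" "j \<le> n" "s = transpose i j"
    using transposition_class[OF assms s] by blast
  obtain k l where kl: "0 < k" "k < l" "l \<le> n" "t = transpose k l"
    using transposition_class[OF assms t] by blast
  have le: "k \<le> i" "j \<le> l" using \<open>low_le s t\<close> low_le_transpose_iff ij kl by auto
  have step: "inv_number n t = inv_number n s + 2"
    if m: "0 < m" "m < n" "s m < s (Suc m)" "s m \<noteq> m \<or> s (Suc m) \<noteq> Suc m"
      and below: "low_le (conj_adj m s) t" for m
  proof -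
    have "conj_adj m s \<in> invol_class n (n - 2)" using s m by (intro conj_adj_in_class)
    moreover have "low_le s (conj_adj m s)"
      by (rule low_le_conj_adj_upper[OF sD(2) sD(2) m(1) low_le_refl m(3)])
    moreover have "conj_adj m s \<noteq> s" using conj_adj_descent_of_ascent[OF m(3,4)] m(3) by auto
    ultimately have "conj_adj m s = t" using between below by blast
    then show ?thesis using inv_number_conj_adj[OF sD(2,1) m] by simp
  qed
  show "inv_number n t = inv_number n s + 2"
  proof (cases "k < i")
    case True
    then obtain m where m: "i = Suc m" by (cases i) auto
    have "conj_adj m s = transpose m j"
      using ij m by (auto simp: conj_adj_def fun_eq_iff transpose_def)
    then have "low_le (conj_adj m s) t" using True m ij kl le low_le_transpose_iff by simp
    then show ?thesis using True m ij kl by (intro step[of m]) auto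
  next
    case False
    then have "j < l" using \<open>s \<noteq> t\<close> le ij(4) kl(4) by (cases "j = l") auto
    have "conj_adj j s = transpose i (Suc j)"
      using ij by (auto simp: conj_adj_def fun_eq_iff transpose_def)
    then have "low_le (conj_adj j s) t" using \<open>j < l\<close> ij kl le low_le_transpose_iff by simp
    then show ?thesis using \<open>j < l\<close> ij kl by (intro step[of j]) auto
  qed
qed

lemma graded_transpositions:
  assumes "n \<ge> 2"
  shows "graded_poset (invol_class n (n - 2)) (bruhat_le n)"
proof (rule graded_invol_class[where w = "transpose 1 n"])
  show "covers_add_two_inversions n (n - 2)"
    using assms by (rule covers_add_two_inversions_transpositions)
  have "{i \<in> {1..n}. transpose 1 n i = i} = {1..n} - {1, n}"
    using assms by (auto simp: transpose_def)
  then have "card {i \<in> {1..n}. transpose 1 n i = i} = n - 2"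
    using assms by (simp add: card_Diff_subset)
  moreover have "transpose 1 n permutes {1..n}"
    using assms by (intro permutes_swap_id) auto
  ultimately show "transpose 1 n \<in> invol_class n (n - 2)"
    by (simp add: invol_class_def)
  fix s assume "s \<in> invol_class n (n - 2)"
  then obtain i j where "0 < i" "i < j" "j \<le> n" "s = transpose i j"
    using transposition_class[OF assms] by blast
  then show "low_le s (transpose 1 n)" by (simp add: low_le_transpose_iff)
qed

text \<open>
  This class consists of the identity alone.
\<close>

lemma graded_identity_class: "graded_poset (invol_class n n) (bruhat_le n)"
proof -
  have id_only: "s = id" if s: "s \<in> invol_class n n" for s
  proof
    fix p
    have all: "{i \<in> {1..n}. s i = i} = {1..n}"
      using invol_classD(3)[OF s] by (intro card_subset_eq) auto
    show "s p = id p"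
    proof (cases "p \<in> {1..n}")
      case True
      then have "p \<in> {i \<in> {1..n}. s i = i}" by (simp only: all)
      then show ?thesis by simp
    next
      case False
      then show ?thesis using invol_classD(5)[OF s, of p] by simp
    qed
  qed
  have "{i \<in> {1..n}. id i = i} = {1..n}" by auto
  then have "id \<in> invol_class n n" by (simp add: invol_class_def permutes_id del: id_apply)
  moreover have "covers_add_two_inversions n n"
    unfolding covers_add_two_inversions_def
  proof (intro allI impI)
    fix s t assume "covers_in (invol_class n n) (bruhat_le n) t s"
    then have "s \<in> invol_class n n" "t \<in> invol_class n n" "s \<noteq> t" unfolding covers_in_def by blast+
    then show "inv_number n t = inv_number n s + 2" using id_only[of s] id_only[of t] by simp
  qed
  moreover have "low_le s id" if "s \<in> invol_class n n" for s
    using id_only[OF that] low_le_refl by simp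
  ultimately show ?thesis by (intro graded_invol_class[where w = id])
qed

section \<open>An interval with maximal chains of different lengths\<close>

text \<open>
  An involution of \<open>{1..6}\<close>, given by the list of its values, followed by \<open>m\<close> two-cycles
  \<open>(7, 8), (9, 10), \<dots>\<close> and then by fixed points.
\<close>

definition tailed :: "nat list \<Rightarrow> nat \<Rightarrow> nat \<Rightarrow> nat" where
  "tailed b m p =
     (if 1 \<le> p \<and> p \<le> 6 then b ! (p - 1)
      else if 7 \<le> p \<and> p \<le> 6 + 2 * m then (if odd p then Suc p else p - 1)
      else p)"

definition list_low_count :: "nat list \<Rightarrow> nat \<Rightarrow> nat \<Rightarrow> nat" where
  "list_low_count b k l = length (filter (\<lambda>x. x \<le> l) (take k b))"

text \<open>
  The value of the involution at \<open>p\<close> is the list entry at index \<open>p - 1\<close>. Two fixed points are required,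
  so that the lists represent the elements of \<open>F\<^sub>6\<^sup>2\<close>.
\<close>

definition involution_list :: "nat list \<Rightarrow> bool" where
  "involution_list b \<longleftrightarrow> length b = 6 \<and> set b \<subseteq> {1..6} \<and>
     (\<forall>p \<in> {1..6}. b ! (b ! (p - 1) - 1) = p) \<and> card {p \<in> {1..6}. b ! (p - 1) = p} = 2"

lemma involution_listD:
  assumes "involution_list b" "1 \<le> p" "p \<le> 6"
  shows "1 \<le> b ! (p - 1)" "b ! (p - 1) \<le> 6" "b ! (b ! (p - 1) - 1) = p"
proof -
  have "b ! (p - 1) \<in> set b" using assms by (intro nth_mem) (auto simp: involution_list_def)
  then show "1 \<le> b ! (p - 1)" "b ! (p - 1) \<le> 6" using assms(1) by (auto simp: involution_list_def)
  show "b ! (b ! (p - 1) - 1) = p" using assms by (simp add: involution_list_def)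
qed

lemma tailed_outside: "p \<notin> {1..6} \<Longrightarrow> tailed b m p = tailed c m p"
  by (auto simp: tailed_def)

lemma tailed_involution:
  assumes "involution_list b"
  shows "tailed b m (tailed b m p) = p"
proof -
  consider "1 \<le> p \<and> p \<le> 6" | "7 \<le> p" "p \<le> 6 + 2 * m" "odd p" | "7 \<le> p" "p \<le> 6 + 2 * m" "even p"
    | "p = 0 \<or> 6 + 2 * m < p" by linarith
  then show ?thesis
  proof cases
    case 1
    then show ?thesis using involution_listD[OF assms, of p] by (simp add: tailed_def)
  next
    case 2
    then have "Suc p \<le> 6 + 2 * m" by presburger
    then show ?thesis using 2 by (simp add: tailed_def)
  next
    case 3
    then have "8 \<le> p" by presburger
    with 3 obtain q where "p = Suc q" "7 \<le> q" "q \<le> 6 + 2 * m" "odd q" by (cases p) auto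
    then show ?thesis by (simp add: tailed_def)
  next
    case 4
    then show ?thesis by (auto simp: tailed_def)
  qed
qed

lemma tailed_in_range:
  assumes "involution_list b" "6 + 2 * m \<le> n" "p \<in> {1..n}"
  shows "tailed b m p \<in> {1..n}"
proof -
  have "odd p \<Longrightarrow> p \<le> 6 + 2 * m \<Longrightarrow> Suc p \<le> 6 + 2 * m" by presburger
  then show ?thesis
    using involution_listD[OF assms(1), of p] assms(2,3) by (auto simp: tailed_def)
qed

lemma tailed_in_class:
  assumes "involution_list b" "2 \<le> a" "n = a + 4 + 2 * m"
  shows "tailed b m \<in> invol_class n a"
proof -
  have n: "6 + 2 * m \<le> n" using assms by simp
  have "bij_betw (tailed b m) {1..n} {1..n}"
    by (rule bij_betwI[where g = "tailed b m"])
       (use tailed_in_range[OF assms(1) n] tailed_involution[OF assms(1)] in blast)+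
  moreover have "tailed b m p = p" if "p \<notin> {1..n}" for p
    using that n by (auto simp: tailed_def)
  ultimately have "tailed b m permutes {1..n}" by (rule bij_imp_permutes)
  moreover have "tailed b m \<circ> tailed b m = id"
    using tailed_involution[OF assms(1)] by (simp add: fun_eq_iff)
  moreover have "{i \<in> {1..n}. tailed b m i = i} = {p \<in> {1..6}. b ! (p - 1) = p} \<union> {7 + 2 * m..n}"
    using n by (auto simp: tailed_def split: if_splits)
  then have "card {i \<in> {1..n}. tailed b m i = i} = card {p \<in> {1..6}. b ! (p - 1) = p} + card {7 + 2 * m..n}"
    by (simp add: card_Un_disjoint disjoint_iff)
  then have "card {i \<in> {1..n}. tailed b m i = i} = a"
    using assms by (simp add: involution_list_def)
  ultimately show ?thesis by (simp add: invol_class_def)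
qed

lemma low_count_tailed:
  assumes "involution_list b" "k \<le> 6"
  shows "low_count (tailed b m) k l = list_low_count b k l"
  using assms(2)
proof (induction k)
  case (Suc k)
  then have "k < length b" using assms(1) by (simp add: involution_list_def)
  then show ?case
    using Suc by (simp add: low_count_Suc list_low_count_def take_Suc_conv_app_nth tailed_def)
qed (simp add: list_low_count_def)

lemma low_count_tailed_full:
  assumes "involution_list b" "k \<le> 6" "6 \<le> l"
  shows "low_count (tailed b m) k l = k"
  unfolding low_count_eq_full_iff
proof (intro allI impI)
  fix i assume "1 \<le> i \<and> i \<le> k"
  then show "tailed b m i \<le> l" using involution_listD(2)[OF assms(1), of i] assms(2,3)
    by (simp add: tailed_def)
qed

text \<open>
  Written as a sum to avoid subtraction: beyond row \<open>6\<close> the difference of the two tables is constant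
  in each column.
\<close>

lemma low_count_tailed_beyond:
  assumes "6 \<le> k"
  shows "low_count (tailed b m) k l + low_count (tailed c m) 6 l =
         low_count (tailed c m) k l + low_count (tailed b m) 6 l"
  using assms by (induction k rule: dec_induct) (simp_all add: low_count_Suc tailed_def)

lemma low_count_tailed_six:
  assumes "involution_list b"
  shows "low_count (tailed b m) 6 l = min 6 l"
proof -
  have "tailed b 0 \<in> invol_class 6 2" using assms by (intro tailed_in_class) auto
  then have "low_count (tailed b 0) 6 l = min 6 l"
    by (intro low_count_permutes_outside[where n = 6] invol_classD(1)) auto
  then show ?thesis using low_count_tailed[OF assms] by simp
qed

text \<open>
  Comparing two such involutions is a finite computation, because their tables agree outside of
  \<open>[0, 6]\<^sup>2\<close>.
\<close>

lemma low_le_tailed: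
  assumes b: "involution_list b" and c: "involution_list c"
    and le: "\<forall>k \<in> {..6}. \<forall>l \<in> {..6}. list_low_count c k l \<le> list_low_count b k l"
  shows "low_le (tailed b m) (tailed c m)"
  unfolding low_le_def
proof (intro allI)
  fix k l :: nat
  consider "6 \<le> k" | "k \<le> 6" "6 \<le> l" | "k \<le> 6" "l \<le> 6" by linarith
  then show "low_count (tailed c m) k l \<le> low_count (tailed b m) k l"
  proof cases
    case 1
    then show ?thesis
      using low_count_tailed_beyond[of k b m l c] low_count_tailed_six[OF b] low_count_tailed_six[OF c]
      by simp
  next
    case 2
    then show ?thesis using low_count_tailed_full[OF b] low_count_tailed_full[OF c] by simp
  next
    case 3
    then show ?thesis using le by (simp add: low_count_tailed[OF b] low_count_tailed[OF c])
  qed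
qed

text \<open>
  The tables of both bounds agree from row \<open>6\<close> on, hence so does that of \<open>z\<close>. Therefore \<open>z\<close> has the same
  tail, and the rest of it is an involution of \<open>{1..6}\<close> with two fixed points.
\<close>

lemma between_tailed:
  assumes b: "involution_list b" and c: "involution_list c"
    and n: "2 \<le> a" "n = a + 4 + 2 * m"
    and z: "z \<in> invol_class n a" and le: "low_le (tailed b m) z" "low_le z (tailed c m)"
  shows "\<And>p. p \<notin> {1..6} \<Longrightarrow> z p = tailed b m p"
    and "\<And>p. p \<in> {1..6} \<Longrightarrow> z p \<in> {1..6}"
    and "card {p \<in> {1..6}. z p = p} = 2"
    and "\<And>k l. k \<le> 6 \<Longrightarrow> list_low_count c k l \<le> low_count z k l \<and> low_count z k l \<le> list_low_count b k l"
proof -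
  note zD = invol_classD[OF z]
  have rows: "low_count (tailed c m) k l \<le> low_count z k l" "low_count z k l \<le> low_count (tailed b m) k l" for k l
    using le by (auto simp: low_le_def)
  have rows_eq: "low_count z k l = low_count (tailed b m) k l" if "6 \<le> k" for k l
    using rows[of k l] low_count_tailed_beyond[OF that, of b m l c]
      low_count_tailed_six[OF b] low_count_tailed_six[OF c] by simp
  show outside: "z p = tailed b m p" if "p \<notin> {1..6}" for p
  proof (cases "p = 0")
    case True
    then show ?thesis using zD(5)[of 0] by (simp add: tailed_def)
  next
    case False
    then have "6 \<le> p - 1" "6 \<le> p" "0 < p" using that by auto
    then show ?thesis using low_count_rows_determine rows_eq by blast
  qed
  show inside: "z p \<in> {1..6}" if p: "p \<in> {1..6}" for p
  proof -
    have "low_count z 6 6 = 6" using rows_eq[of 6 6] low_count_tailed_six[OF b] by simp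
    then have "z p \<le> 6" using p by (simp add: low_count_eq_full_iff)
    moreover have "0 < z p" using p zD(2) by simp
    ultimately show ?thesis by simp
  qed
  show "card {p \<in> {1..6}. z p = p} = 2"
  proof -
    have split: "{p \<in> {1..n}. s p = p} = {p \<in> {1..6}. s p = p} \<union> {p \<in> {7..n}. s p = p}" for s :: "nat \<Rightarrow> nat"
      using n by auto
    have sum: "card {p \<in> {1..n}. s p = p} = card {p \<in> {1..6}. s p = p} + card {p \<in> {7..n}. s p = p}" for s :: "nat \<Rightarrow> nat"
      unfolding split by (rule card_Un_disjoint) auto
    have "{p \<in> {7..n}. z p = p} = {p \<in> {7..n}. tailed b m p = p}"
    proof (rule Collect_cong)
      fix p
      have "p \<in> {7..n} \<Longrightarrow> p \<notin> {1..6}" by simp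
      then show "p \<in> {7..n} \<and> z p = p \<longleftrightarrow> p \<in> {7..n} \<and> tailed b m p = p"
        using outside[of p] by metis
    qed
    then have "card {p \<in> {1..6}. z p = p} = card {p \<in> {1..6}. tailed b m p = p}"
      using sum[of z] sum[of "tailed b m"] zD(3) invol_classD(3)[OF tailed_in_class[OF b n]] by simp
    also have "{p \<in> {1..6}. tailed b m p = p} = {p \<in> {1..6}. b ! (p - 1) = p}"
      by (auto simp: tailed_def)
    finally show ?thesis using b by (simp add: involution_list_def)
  qed
  show "list_low_count c k l \<le> low_count z k l \<and> low_count z k l \<le> list_low_count b k l" if "k \<le> 6" for k l
    using rows[of k l] low_count_tailed[OF b that] low_count_tailed[OF c that] by simp
qed

lemma atLeastAtMost_1_6: "{1..6::nat} = {1, 2, 3, 4, 5, 6}" by auto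

lemma low_count_numerals:
  "low_count z 1 l = of_bool (z 1 \<le> l)"
  "low_count z 2 l = of_bool (z 1 \<le> l) + of_bool (z 2 \<le> l)"
  "low_count z 3 l = of_bool (z 1 \<le> l) + of_bool (z 2 \<le> l) + of_bool (z 3 \<le> l)"
  "low_count z 4 l = of_bool (z 1 \<le> l) + of_bool (z 2 \<le> l) + of_bool (z 3 \<le> l) + of_bool (z 4 \<le> l)"
  "low_count z 5 l = of_bool (z 1 \<le> l) + of_bool (z 2 \<le> l) + of_bool (z 3 \<le> l) + of_bool (z 4 \<le> l)
     + of_bool (z 5 \<le> l)"
  by (simp_all add: eval_nat_numeral low_count_Suc)

lemma eq_tailedI:
  assumes "\<And>p. p \<notin> {1..6} \<Longrightarrow> z p = tailed b m p"
    and "b = [z 1, z 2, z 3, z 4, z 5, z 6]"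
  shows "z = tailed b m"
proof
  fix p
  show "z p = tailed b m p"
  proof (cases "p \<in> {1..6}")
    case True
    then show ?thesis unfolding atLeastAtMost_1_6 by (subst assms(2)) (auto simp: tailed_def)
  qed (rule assms(1))
qed

lemma card_fixed_six:
  fixes z :: "nat \<Rightarrow> nat"
  shows "card {p \<in> {1..6}. z p = p} = of_bool (z 1 = 1) + of_bool (z 2 = 2) + of_bool (z 3 = 3)
     + of_bool (z 4 = 4) + of_bool (z 5 = 5) + of_bool (z 6 = 6)"
proof -
  have "card {p \<in> {1..6}. z p = p} = (\<Sum>p\<in>{1..6}. of_bool (z p = p))"
    by (simp add: of_bool_def sum.If_cases Int_def)
  then show ?thesis unfolding atLeastAtMost_1_6 by simp
qed

lemma involution_lists:
  "involution_list [2,1,4,3,5,6]" "involution_list [4,2,3,1,6,5]" "involution_list [4,2,6,1,5,3]"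
  "involution_list [2,1,5,4,3,6]" "involution_list [2,1,6,4,5,3]"
  unfolding involution_list_def card_fixed_six unfolding atLeastAtMost_1_6 by simp_all

lemma between_tailed_entries:
  assumes z: "invol z" and range: "\<And>p. p \<in> {1..6} \<Longrightarrow> z p \<in> {1..6}" and p: "p \<in> {1..6}"
  shows "z p = 1 \<or> z p = 2 \<or> z p = 3 \<or> z p = 4 \<or> z p = 5 \<or> z p = 6"
  using range[OF p] unfolding atLeastAtMost_1_6 by simp

text \<open>
  From here on, an involution of \<open>{1..6}\<close> is written by its cycles. This is the step from \<open>(12)(34)\<close>
  to \<open>(14)(56)\<close>, which adds four inversions. An element \<open>z\<close> between them preserves \<open>{1..4}\<close>,
  hence also \<open>{5, 6}\<close>. The counts at \<open>(1, 1)\<close>, \<open>(2, 2)\<close> and \<open>(3, 3)\<close> leave only \<open>2\<close> and \<open>4\<close> as the value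
  of \<open>z\<close> at \<open>1\<close>. Each of them determines \<open>z\<close> on \<open>{1..4}\<close>, and the number of fixed points does the rest.
\<close>

lemma nothing_between_first_and_second:
  assumes n: "2 \<le> a" "n = a + 4 + 2 * m" and z: "z \<in> invol_class n a"
    and le: "low_le (tailed [2,1,4,3,5,6] m) z" "low_le z (tailed [4,2,3,1,6,5] m)"
  shows "z = tailed [2,1,4,3,5,6] m \<or> z = tailed [4,2,3,1,6,5] m"
proof -
  note b = between_tailed[OF involution_lists(1,2) n z le]
  have zI: "invol z" using invol_classD(2)[OF z] .
  note entries = between_tailed_entries[OF zI b(2)]
  have outside: "z p = tailed d m p" if "p \<notin> {1..6}" for p d
    by (rule trans[OF b(1)[OF that] tailed_outside[OF that]])
  have zz: "z q = p" if "z p = q" for p q using that zI by auto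
  have ne: "z p \<noteq> z q" if "p \<noteq> q" for p q using invol_eq_iff[OF zI] that by simp
  have fixed: "of_bool (z 1 = 1) + of_bool (z 2 = 2) + of_bool (z 3 = 3)
     + of_bool (z 4 = 4) + of_bool (z 5 = 5) + of_bool (z 6 = 6) = (2::nat)"
    using b(3) unfolding card_fixed_six .
  have c11: "\<not> z 1 \<le> 1" and c22: "z 1 \<le> 2 \<or> z 2 \<le> 2"
    and c33: "\<not> (z 1 \<le> 3 \<and> z 2 \<le> 3 \<and> z 3 \<le> 3)"
    and c44: "z 1 \<le> 4" "z 2 \<le> 4" "z 3 \<le> 4" "z 4 \<le> 4"
  proof -
    have counts: "low_count z 1 1 \<le> 0" "1 \<le> low_count z 2 2" "low_count z 3 3 \<le> 2" "4 \<le> low_count z 4 4"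
      using b(4)[of 1 1] b(4)[of 2 2] b(4)[of 3 3] b(4)[of 4 4] by (simp_all add: list_low_count_def)
    show "\<not> z 1 \<le> 1" using counts(1) unfolding low_count_numerals by (cases "z 1 \<le> 1") simp_all
    show "z 1 \<le> 2 \<or> z 2 \<le> 2"
      using counts(2) unfolding low_count_numerals by (cases "z 1 \<le> 2"; cases "z 2 \<le> 2") simp_all
    show "\<not> (z 1 \<le> 3 \<and> z 2 \<le> 3 \<and> z 3 \<le> 3)"
    proof
      assume "z 1 \<le> 3 \<and> z 2 \<le> 3 \<and> z 3 \<le> 3"
      then show False using counts(3) unfolding low_count_numerals by simp
    qed
    have "low_count z 4 4 = 4" using counts(4) low_count_le[of z 4 4] by simp
    then show "z 1 \<le> 4" "z 2 \<le> 4" "z 3 \<le> 4" "z 4 \<le> 4"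
      unfolding low_count_eq_full_iff by simp_all
  qed
  have top: "z 5 = 5 \<and> z 6 = 6 \<or> z 5 = 6 \<and> z 6 = 5"
  proof -
    have "z p = 5 \<or> z p = 6" if p: "p = 5 \<or> p = 6" for p
    proof (rule ccontr)
      assume "\<not> ?thesis"
      then have "z p = 1 \<or> z p = 2 \<or> z p = 3 \<or> z p = 4" using entries[of p] p by auto
      then have "z (z p) \<le> 4" using c44 by auto
      then show False using p zI by auto
    qed
    from this[of 5] this[of 6] ne[of 5 6] show ?thesis by auto
  qed
  consider "z 1 = 2" | "z 1 = 3" | "z 1 = 4" using entries[of 1] c11 c44(1) by auto
  then show ?thesis
  proof cases
    case 1
    note z1 = 1
    have z2: "z 2 = 1" by (rule zz[OF z1])
    have z3: "z 3 = 4" using c33 c44(3) z1 z2 by simp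
    have z4: "z 4 = 3" by (rule zz[OF z3])
    have "z 5 = 5 \<and> z 6 = 6" using top fixed z1 z2 z3 z4 by auto
    then have "z = tailed [2,1,4,3,5,6] m"
      using z1 z2 z3 z4 by (intro eq_tailedI outside) auto
    then show ?thesis ..
  next
    case 2
    note z1 = 2
    have z3: "z 3 = 1" by (rule zz[OF z1])
    have "z 2 = 4" using c33 c44(2) z1 z3 by simp
    then show ?thesis using c22 z1 by simp
  next
    case 3
    note z1 = 3
    have z4: "z 4 = 1" by (rule zz[OF z1])
    have z2: "z 2 = 2" using c22 z1 entries[of 2] ne[of 2 4] z4 by auto
    have z3: "z 3 = 3" using c44(3) entries[of 3] ne[of 3 1] ne[of 3 2] ne[of 3 4] z1 z2 z4 by auto
    have "z 5 = 6 \<and> z 6 = 5" using top fixed z1 z2 z3 z4 by auto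
    then have "z = tailed [4,2,3,1,6,5] m"
      using z1 z2 z3 z4 by (intro eq_tailedI outside) auto
    then show ?thesis ..
  qed
qed

text \<open>
  The step from \<open>(14)(56)\<close> to \<open>(14)(36)\<close>. The first two rows of both tables agree and determine the
  values of \<open>z\<close> at \<open>1\<close> and \<open>2\<close>, hence also at \<open>4\<close>. Of the three remaining candidates \<open>(14)(35)\<close> is excluded
  by the count at \<open>(5, 5)\<close>.
\<close>

lemma nothing_between_second_and_third:
  assumes n: "2 \<le> a" "n = a + 4 + 2 * m" and z: "z \<in> invol_class n a"
    and le: "low_le (tailed [4,2,3,1,6,5] m) z" "low_le z (tailed [4,2,6,1,5,3] m)"
  shows "z = tailed [4,2,3,1,6,5] m \<or> z = tailed [4,2,6,1,5,3] m"
proof -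
  note b = between_tailed[OF involution_lists(2,3) n z le]
  have zI: "invol z" using invol_classD(2)[OF z] .
  note entries = between_tailed_entries[OF zI b(2)]
  have outside: "z p = tailed d m p" if "p \<notin> {1..6}" for p d
    by (rule trans[OF b(1)[OF that] tailed_outside[OF that]])
  have zz: "z q = p" if "z p = q" for p q using that zI by auto
  have ne: "z p \<noteq> z q" if "p \<noteq> q" for p q using invol_eq_iff[OF zI] that by simp
  have fixed: "of_bool (z 1 = 1) + of_bool (z 2 = 2) + of_bool (z 3 = 3)
     + of_bool (z 4 = 4) + of_bool (z 5 = 5) + of_bool (z 6 = 6) = (2::nat)"
    using b(3) unfolding card_fixed_six .
  have z1_le: "z 1 \<le> 4" and z1_gt: "\<not> z 1 \<le> 3" and c22: "z 1 \<le> 2 \<or> z 2 \<le> 2"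
    and c55: "\<not> (z 1 \<le> 5 \<and> z 2 \<le> 5 \<and> z 3 \<le> 5 \<and> z 4 \<le> 5 \<and> z 5 \<le> 5)"
  proof -
    have counts: "1 \<le> low_count z 1 4" "low_count z 1 3 \<le> 0" "1 \<le> low_count z 2 2" "low_count z 5 5 \<le> 4"
      using b(4)[of 1 4] b(4)[of 1 3] b(4)[of 2 2] b(4)[of 5 5] by (simp_all add: list_low_count_def)
    show "z 1 \<le> 4" using counts(1) unfolding low_count_numerals by (cases "z 1 \<le> 4") simp_all
    show "\<not> z 1 \<le> 3" using counts(2) unfolding low_count_numerals by (cases "z 1 \<le> 3") simp_all
    show "z 1 \<le> 2 \<or> z 2 \<le> 2"
      using counts(3) unfolding low_count_numerals by (cases "z 1 \<le> 2"; cases "z 2 \<le> 2") simp_all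
    show "\<not> (z 1 \<le> 5 \<and> z 2 \<le> 5 \<and> z 3 \<le> 5 \<and> z 4 \<le> 5 \<and> z 5 \<le> 5)"
    proof
      assume "z 1 \<le> 5 \<and> z 2 \<le> 5 \<and> z 3 \<le> 5 \<and> z 4 \<le> 5 \<and> z 5 \<le> 5"
      then show False using counts(4) unfolding low_count_numerals by simp
    qed
  qed
  have z1: "z 1 = 4" using z1_le z1_gt by simp
  have z4: "z 4 = 1" by (rule zz[OF z1])
  have z2: "z 2 = 2" using c22 z1 entries[of 2] ne[of 2 4] z4 by auto
  consider "z 3 = 3" | "z 3 = 5" | "z 3 = 6"
    using entries[of 3] ne[of 3 1] ne[of 3 2] ne[of 3 4] z1 z2 z4 by auto
  then show ?thesis
  proof cases
    case 1
    note z3 = 1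
    have "z 5 \<noteq> 5" using fixed z1 z2 z3 z4 by auto
    then have z5: "z 5 = 6"
      using entries[of 5] ne[of 5 1] ne[of 5 2] ne[of 5 3] ne[of 5 4] z1 z2 z3 z4 by auto
    have z6: "z 6 = 5" by (rule zz[OF z5])
    have "z = tailed [4,2,3,1,6,5] m"
      using z1 z2 z3 z4 z5 z6 by (intro eq_tailedI outside) auto
    then show ?thesis ..
  next
    case 2
    then have "z 5 = 3" by (rule zz)
    then show ?thesis using c55 z1 z2 2 z4 by simp
  next
    case 3
    note z3 = 3
    have z6: "z 6 = 3" by (rule zz[OF z3])
    have z5: "z 5 = 5"
      using entries[of 5] ne[of 5 1] ne[of 5 2] ne[of 5 3] ne[of 5 4] ne[of 5 6] z1 z2 z3 z4 z6 by auto
    have "z = tailed [4,2,6,1,5,3] m"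
      using z1 z2 z3 z4 z5 z6 by (intro eq_tailedI outside) auto
    then show ?thesis ..
  qed
qed

lemma atMost_6: "{..6::nat} = {0, 1, 2, 3, 4, 5, 6}" by auto

lemma list_low_count_comparisons:
  "\<forall>k \<in> {..6}. \<forall>l \<in> {..6}. list_low_count [4,2,3,1,6,5] k l \<le> list_low_count [2,1,4,3,5,6] k l"
  "\<forall>k \<in> {..6}. \<forall>l \<in> {..6}. list_low_count [4,2,6,1,5,3] k l \<le> list_low_count [4,2,3,1,6,5] k l"
  "\<forall>k \<in> {..6}. \<forall>l \<in> {..6}. list_low_count [2,1,5,4,3,6] k l \<le> list_low_count [2,1,4,3,5,6] k l"
  "\<forall>k \<in> {..6}. \<forall>l \<in> {..6}. list_low_count [2,1,6,4,5,3] k l \<le> list_low_count [2,1,5,4,3,6] k l"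
  "\<forall>k \<in> {..6}. \<forall>l \<in> {..6}. list_low_count [4,2,6,1,5,3] k l \<le> list_low_count [2,1,6,4,5,3] k l"
  unfolding atMost_6 list_low_count_def by simp_all

text \<open>
  Between \<open>(12)(34)\<close> and \<open>(14)(36)\<close> there is a chain of covers through \<open>(14)(56)\<close>, and the longer chain
  through \<open>(12)(35)\<close> and \<open>(12)(36)\<close>.
\<close>

lemma not_graded:
  assumes "2 \<le> a" "n = a + 4 + 2 * m"
  shows "\<not> graded_poset (invol_class n a) (bruhat_le n)"
proof -
  interpret finite_poset "invol_class n a" "bruhat_le n" by (rule finite_poset_invol_class)
  note in_class = involution_lists[THEN tailed_in_class, OF assms]
  have le: "low_le (tailed [2,1,4,3,5,6] m) (tailed [4,2,3,1,6,5] m)"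
    "low_le (tailed [4,2,3,1,6,5] m) (tailed [4,2,6,1,5,3] m)"
    "low_le (tailed [2,1,4,3,5,6] m) (tailed [2,1,5,4,3,6] m)"
    "low_le (tailed [2,1,5,4,3,6] m) (tailed [2,1,6,4,5,3] m)"
    "low_le (tailed [2,1,6,4,5,3] m) (tailed [4,2,6,1,5,3] m)"
    by (intro low_le_tailed involution_lists list_low_count_comparisons)+
  have differ: "tailed b m \<noteq> tailed c m" if "b ! 0 \<noteq> c ! 0 \<or> b ! 2 \<noteq> c ! 2" for b c
  proof
    assume "tailed b m = tailed c m"
    then have "tailed b m 1 = tailed c m 1" "tailed b m 3 = tailed c m 3" by simp_all
    then show False using that by (simp add: tailed_def)
  qed
  show ?thesis
  proof (rule not_graded_if_two_chains)
    show "covers_in (invol_class n a) (bruhat_le n) (tailed [4,2,3,1,6,5] m) (tailed [2,1,4,3,5,6] m)"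
      unfolding covers_in_def using in_class le differ nothing_between_first_and_second[OF assms]
      by (auto simp: bruhat_le_in_class)
    show "covers_in (invol_class n a) (bruhat_le n) (tailed [4,2,6,1,5,3] m) (tailed [4,2,3,1,6,5] m)"
      unfolding covers_in_def using in_class le differ nothing_between_second_and_third[OF assms]
      by (auto simp: bruhat_le_in_class)
    show "tailed [2,1,5,4,3,6] m \<in> invol_class n a" "tailed [2,1,6,4,5,3] m \<in> invol_class n a"
      by (rule in_class)+
    show "bruhat_le n (tailed [2,1,4,3,5,6] m) (tailed [2,1,5,4,3,6] m)"
      "bruhat_le n (tailed [2,1,5,4,3,6] m) (tailed [2,1,6,4,5,3] m)"
      "bruhat_le n (tailed [2,1,6,4,5,3] m) (tailed [4,2,6,1,5,3] m)"
      using le in_class by (simp_all add: bruhat_le_in_class)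
    show "tailed [2,1,4,3,5,6] m \<noteq> tailed [2,1,5,4,3,6] m"
      "tailed [2,1,5,4,3,6] m \<noteq> tailed [2,1,6,4,5,3] m"
      "tailed [2,1,6,4,5,3] m \<noteq> tailed [4,2,6,1,5,3] m"
      by (rule differ, simp)+
  qed
qed

theorem corollary2:
  fixes n :: nat
  shows "(\<forall>a\<in>{0..n}. invol_class n a \<noteq> {} \<longrightarrow>
            (graded_poset (invol_class n a) (bruhat_le n) \<longleftrightarrow>
               int a \<in> {0, 1, int n - 2, int n}))
       \<and> (even n \<longrightarrow>
            rank_function_given_by (invol_class n 0) (bruhat_le n)
              (\<lambda>\<sigma>. (real (inv_number n \<sigma>) - of_int \<lfloor>real n / 2\<rfloor>) / 2))
       \<and> (odd n \<longrightarrow>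
            rank_function_given_by (invol_class n 1) (bruhat_le n)
              (\<lambda>\<sigma>. (real (inv_number n \<sigma>) - of_int \<lfloor>real n / 2\<rfloor>) / 2))
       \<and> (n \<ge> 2 \<longrightarrow>
            rank_function_given_by (invol_class n (n - 2)) (bruhat_le n)
              (\<lambda>\<sigma>. (real (inv_number n \<sigma>) - 1) / 2))"
proof (intro conjI ballI impI)
  fix a assume a: "a \<in> {0..n}" and nonempty: "invol_class n a \<noteq> {}"
  show "graded_poset (invol_class n a) (bruhat_le n) \<longleftrightarrow> int a \<in> {0, 1, int n - 2, int n}"
  proof
    assume "int a \<in> {0, 1, int n - 2, int n}"
    then consider "a \<le> 1" | "2 \<le> n" "a = n - 2" | "a = n" by force
    then show "graded_poset (invol_class n a) (bruhat_le n)"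
    proof cases
      case 1
      then show ?thesis using nonempty by (rule graded_few_fixed_points)
    next
      case 2
      then show ?thesis using graded_transpositions by simp
    next
      case 3
      then show ?thesis using graded_identity_class by simp
    qed
  next
    assume graded: "graded_poset (invol_class n a) (bruhat_le n)"
    show "int a \<in> {0, 1, int n - 2, int n}"
    proof (rule ccontr)
      assume not_in: "int a \<notin> {0, 1, int n - 2, int n}"
      obtain s where "s \<in> invol_class n a" using nonempty by blast
      then have size: "n = a + 2 * card {p \<in> {1..n}. p < s p}" by (rule invol_class_size)
      define c where "c = card {p \<in> {1..n}. p < s p}"
      have nc: "n = a + 2 * c" using size by (simp only: c_def)
      then have "2 \<le> a" "2 \<le> c" using not_in by auto
      then have "n = a + 4 + 2 * (c - 2)" using nc by simp
      then show False using not_graded \<open>2 \<le> a\<close> graded by blast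
    qed
  qed
next
  have half: "real (n div 2) = of_int \<lfloor>real n / 2\<rfloor>"
    using floor_divide_of_nat_eq[of n 2, where 'a = real] by simp
  show "rank_function_given_by (invol_class n 0) (bruhat_le n)
              (\<lambda>\<sigma>. (real (inv_number n \<sigma>) - of_int \<lfloor>real n / 2\<rfloor>) / 2)" if "even n"
    using rank_function_invol_class[OF covers_add_two_inversions_few_fixed_points[of 0 n]]
    by (simp add: half)
  show "rank_function_given_by (invol_class n 1) (bruhat_le n)
              (\<lambda>\<sigma>. (real (inv_number n \<sigma>) - of_int \<lfloor>real n / 2\<rfloor>) / 2)" if "odd n"
  proof -
    have "(n - 1) div 2 = n div 2" using that by presburger
    then show ?thesis
      using rank_function_invol_class[OF covers_add_two_inversions_few_fixed_points[of 1 n]]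
      by (simp only: half)
  qed
  show "rank_function_given_by (invol_class n (n - 2)) (bruhat_le n)
              (\<lambda>\<sigma>. (real (inv_number n \<sigma>) - 1) / 2)" if "n \<ge> 2"
    using rank_function_invol_class[OF covers_add_two_inversions_transpositions[OF that]] that
    by simp
qed

end
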